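(* For every $\beta\in(0,1/2)$ there exists a constant $c_\beta>0$, depending only on $\beta$ (in particular independent of the dimension), such that for every integer $d\ge1$, if $\mu$ denotes the probability measure on $\mathbf R^d$ with $\mu(dx)\propto\exp(-|x|^4/4+\beta|x|^2/2)\,dx$, then for any $f\in\mathcal C_c^\infty(\mathbf R^d,\mathbf R)$, $$\mathrm{Ent}_\mu(f^2)\le c_\beta\int_{\mathbf R^d}|\nabla f|^2\,d\mu.$$
   Context: $|\cdot|$ is the Euclidean norm on $\mathbf R^d$; $\mathcal C_c^\infty(\mathbf R^d,\mathbf R)$ is the set of compactly supported smooth functions. $\mathrm{Ent}_\mu(f^2)=\int_{\mathbf R^d}f^2\log(f^2)\,d\mu-\left(\int_{\mathbf R^d}f^2\,d\mu\right)\log\left(\int_{\mathbf R^d}f^2\,d\mu\right)$, with $0\log0=0$. *)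

theory Defs
  imports "HOL-Probability.Probability"
begin

text \<open>
  The constant in the inequality must not depend on the dimension, so the dimension
  has to be an object-level variable. Hence \<open>\<real>\<^sup>d\<close> is the set of functions
  \<open>{..<d} \<rightarrow>\<^sub>E UNIV\<close> rather than a type; it is both the topspace of \<open>euclid d\<close> and the
  space of \<open>lebesgue_measure d\<close>. The Euclidean norm of such an \<open>x\<close> is \<open>L2_set x {..<d}\<close>.
\<close>

definition euclid :: "nat \<Rightarrow> (nat \<Rightarrow> real) topology" where
  "euclid d = product_topology (\<lambda>_. euclideanreal) {..<d}"

definition lebesgue_measure :: "nat \<Rightarrow> (nat \<Rightarrow> real) measure" where
  "lebesgue_measure d = PiM {..<d} (\<lambda>_. lborel)"

definition partial_deriv :: "nat \<Rightarrow> ((nat \<Rightarrow> real) \<Rightarrow> real) \<Rightarrow> (nat \<Rightarrow> real) \<Rightarrow> real" where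
  "partial_deriv i f x = deriv (\<lambda>t. f (x(i := t))) (x i)"

definition has_partial_deriv :: "nat \<Rightarrow> ((nat \<Rightarrow> real) \<Rightarrow> real) \<Rightarrow> (nat \<Rightarrow> real) \<Rightarrow> bool" where
  "has_partial_deriv i f x \<longleftrightarrow> (\<lambda>t. f (x(i := t))) field_differentiable (at (x i))"

definition grad :: "nat \<Rightarrow> ((nat \<Rightarrow> real) \<Rightarrow> real) \<Rightarrow> (nat \<Rightarrow> real) \<Rightarrow> (nat \<Rightarrow> real)" where
  "grad d f x = (\<lambda>i\<in>{..<d}. partial_deriv i f x)"

text \<open>Smoothness: the partial derivatives of all orders exist everywhere and are continuous.
  The list \<open>js\<close> is a multi-index given as the sequence of differentiation variables.\<close>

definition smooth :: "nat \<Rightarrow> ((nat \<Rightarrow> real) \<Rightarrow> real) \<Rightarrow> bool" where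
  "smooth d f \<longleftrightarrow>
     (\<forall>js\<in>lists {..<d}.
        continuous_map (euclid d) euclideanreal (foldr partial_deriv js f) \<and>
        (\<forall>i<d. \<forall>x\<in>topspace (euclid d). has_partial_deriv i (foldr partial_deriv js f) x))"

definition compact_support :: "nat \<Rightarrow> ((nat \<Rightarrow> real) \<Rightarrow> real) \<Rightarrow> bool" where
  "compact_support d f \<longleftrightarrow>
     compactin (euclid d) (euclid d closure_of {x \<in> topspace (euclid d). f x \<noteq> 0})"

text \<open>Only the values on \<open>topspace (euclid d)\<close> matter; elsewhere the members are arbitrary.\<close>

definition Cc_infty :: "nat \<Rightarrow> ((nat \<Rightarrow> real) \<Rightarrow> real) set" where
  "Cc_infty d = {f. smooth d f \<and> compact_support d f}"

definition weight :: "real \<Rightarrow> nat \<Rightarrow> (nat \<Rightarrow> real) \<Rightarrow> real" where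
  "weight \<beta> d x = exp (- ((L2_set x {..<d}) ^ 4) / 4 + \<beta> * (L2_set x {..<d})\<^sup>2 / 2)"

definition gibbs :: "real \<Rightarrow> nat \<Rightarrow> (nat \<Rightarrow> real) measure" where
  "gibbs \<beta> d = density (lebesgue_measure d)
     (\<lambda>x. ennreal (weight \<beta> d x / (LINT y|lebesgue_measure d. weight \<beta> d y)))"

text \<open>\<open>Ent \<mu> g\<close> for nonnegative \<open>g\<close>; since \<open>0 * ln 0 = 0\<close>, the convention \<open>0 log 0 = 0\<close>
  is built in.\<close>

definition Ent :: "'a measure \<Rightarrow> ('a \<Rightarrow> real) \<Rightarrow> real" where
  "Ent \<mu> g = (LINT x|\<mu>. g x * ln (g x)) - (LINT x|\<mu>. g x) * ln (LINT x|\<mu>. g x)"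

lemma space_lebesgue_measure: "space (lebesgue_measure d) = topspace (euclid d)"
  by (simp add: lebesgue_measure_def euclid_def space_PiM)

lemma weight_measurable [measurable]: "weight \<beta> d \<in> borel_measurable (lebesgue_measure d)"
  unfolding weight_def lebesgue_measure_def L2_set_def by measurable

lemma weight_pos: "weight \<beta> d x > 0"
  by (simp add: weight_def)

lemma integrable_weight: "integrable (lebesgue_measure d) (weight \<beta> d)"
proof -
  interpret product_sigma_finite "\<lambda>_::nat. lborel :: real measure" ..
  have g: "integrable lborel (\<lambda>t::real. exp (- t\<^sup>2 / 2))"
  proof -
    have "integrable lborel (\<lambda>t::real. sqrt (2 * pi) * std_normal_density t)"
      by (intro integrable_mult_right integrable_normal_density) auto
    then show ?thesis by (simp add: std_normal_density_def)
  qed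
  have "integrable (lebesgue_measure d) (\<lambda>x. \<Prod>i<d. exp (- (x i)\<^sup>2 / 2))"
    unfolding lebesgue_measure_def by (intro product_integrable_prod g) auto
  then have *: "integrable (lebesgue_measure d)
      (\<lambda>x. exp ((\<beta> + 1)\<^sup>2 / 4) * (\<Prod>i<d. exp (- (x i)\<^sup>2 / 2)))"
    by simp
  show ?thesis
  proof (rule Bochner_Integration.integrable_bound[OF * weight_measurable], rule AE_I2)
    fix x :: "nat \<Rightarrow> real"
    define s where "s = (\<Sum>i<d. (x i)\<^sup>2)"
    have s: "s \<ge> 0" by (simp add: s_def sum_nonneg)
    have L: "(L2_set x {..<d})\<^sup>2 = s"
      using s by (simp add: L2_set_def s_def)
    have "(L2_set x {..<d}) ^ 4 = ((L2_set x {..<d})\<^sup>2)\<^sup>2"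
      by simp
    then have w: "weight \<beta> d x = exp (- s\<^sup>2 / 4 + \<beta> * s / 2)"
      unfolding weight_def by (simp add: L)
    have p: "(\<Prod>i<d. exp (- (x i)\<^sup>2 / 2)) = exp (- s / 2)"
      by (simp add: s_def exp_sum[symmetric] sum_negf sum_divide_distrib)
    have "0 \<le> (s / 2 - (\<beta> + 1) / 2)\<^sup>2" by simp
    then have "- s\<^sup>2 / 4 + \<beta> * s / 2 \<le> (\<beta> + 1)\<^sup>2 / 4 + - s / 2"
      by (simp add: power2_eq_square field_simps)
    then show "norm (weight \<beta> d x)
        \<le> norm (exp ((\<beta> + 1)\<^sup>2 / 4) * (\<Prod>i<d. exp (- (x i)\<^sup>2 / 2)))"
      unfolding p w by (simp add: exp_add[symmetric])
  qed
qed

lemma prob_space_gibbs: "prob_space (gibbs \<beta> d)"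
proof
  interpret product_sigma_finite "\<lambda>_::nat. lborel :: real measure" ..
  let ?M = "lebesgue_measure d" and ?w = "weight \<beta> d"
  define Z where "Z = (LINT y|?M. ?w y)"
  have pos: "emeasure ?M (space ?M) \<noteq> 0"
    unfolding lebesgue_measure_def by (simp add: space_PiM emeasure_PiM)
  have "Z \<noteq> 0"
  proof
    assume "Z = 0"
    then have "AE x in ?M. ?w x = 0"
      unfolding Z_def using integral_nonneg_eq_0_iff_AE[OF integrable_weight]
      by (simp add: weight_pos less_imp_le)
    then have "AE x in ?M. False"
      by (rule AE_mp) (simp add: weight_pos less_imp_neq[symmetric])
    then have "emeasure ?M (space ?M) = 0"
      by (simp add: AE_iff_measurable[OF sets.top])
    with pos show False by simp
  qed
  moreover have "Z \<ge> 0"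
    unfolding Z_def by (intro Bochner_Integration.integral_nonneg) (simp add: weight_pos less_imp_le)
  ultimately have Z: "Z > 0" by simp
  have "emeasure (gibbs \<beta> d) (space (gibbs \<beta> d)) = (\<integral>\<^sup>+x. ennreal (?w x / Z) \<partial>?M)"
    unfolding gibbs_def Z_def[symmetric] by (simp add: emeasure_density cong: nn_integral_cong)
  also have "\<dots> = ennreal (LINT x|?M. ?w x / Z)"
    using Z by (intro nn_integral_eq_integral) (auto simp: integrable_weight weight_pos less_imp_le)
  also have "\<dots> = 1" using Z by (simp add: Z_def[symmetric])
  finally show "emeasure (gibbs \<beta> d) (space (gibbs \<beta> d)) = 1" .
qed

end

theory Submission
  imports Defs "HOL-Real_Asymp.Real_Asymp"
begin

text \<open>
  The potential \<open>|x|\<^sup>4 / 4 - \<beta> |x|\<^sup>2 / 2\<close> fails to be convex only near the origin, and it is a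
  function of \<open>r = |x|\<^sup>2\<close> alone. Changing it for \<open>r < \<beta> + 1\<close> produces a potential
  \<open>W x = |x|\<^sup>2 / 2 + (max (|x|\<^sup>2 - (\<beta> + 1)) 0)\<^sup>2 / 4\<close> that is strongly convex with constant 1 in
  every dimension (\<open>strongly_convex_radial\<close>) and whose distance from the original one is at most
  \<open>(\<beta> + 1)\<^sup>2 / 4\<close>, again in every dimension (\<open>quartic_within_bounded_distance_of_convex\<close>).
  Strongly log-concave measures satisfy a logarithmic Sobolev inequality with the dimension-free
  constant 2, and a bounded perturbation of the potential changes the constant by a bounded factor
  (\<open>entropy_comparison\<close>, due to Holley and Stroock). The constant obtained is
  \<open>2 exp ((\<beta> + 1)\<^sup>2 / 4)\<close>.

  The inequality for strongly log-concave measures is derived, following Bobkov and Ledoux, from the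
  Prekopa-Leindler inequality, which needs no semigroups and no transport maps and is proved by
  induction on the dimension from Brunn-Minkowski on the line (\<open>prekopa_leindler\<close>). Apply it to
  \<open>u = exp ((1 + 1/m) g - W)\<close> and \<open>v = exp (- W)\<close> with weights \<open>m / (m + 1)\<close> and \<open>1 / (m + 1)\<close>:
  strong convexity permits \<open>w = exp (g + |\<nabla>g|\<^sup>2 / (2 m) - W)\<close> up to lower order. As \<open>m \<rightarrow> \<infinity>\<close> the
  inequality becomes an equality to leading order, and the next order is the logarithmic Sobolev
  inequality for \<open>exp g\<close> (\<open>log_sobolev_strongly_convex\<close>). It is used for \<open>exp g = f\<^sup>2 + \<epsilon>\<close>, and
  \<open>\<epsilon> \<rightarrow> 0\<close> is taken at the very end.
\<close>

section \<open>Brunn-Minkowski on the line\<close>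

text \<open>
  On the line no rearrangement or compactness is needed: \<open>C\<close> contains a translate of \<open>t A\<close>
  (move \<open>A\<close> by one point of \<open>B\<close>) and a translate of \<open>s B\<close>. Taking the fixed points close to
  \<open>Sup A\<close> and to \<open>Inf B\<close> puts the first translate almost to the left of the second, so that
  their overlap has arbitrarily small length.
\<close>

lemma brunn_minkowski_bounded:
  fixes A B C :: "real set"
  assumes t: "0 < t" "0 < s" "t + s = (1::real)"
    and meas: "A \<in> sets borel" "B \<in> sets borel" "C \<in> sets borel"
    and ne: "A \<noteq> {}" "B \<noteq> {}"
    and bdd: "bounded A" "bounded B"
    and sub: "\<And>a b. a \<in> A \<Longrightarrow> b \<in> B \<Longrightarrow> t * a + s * b \<in> C"
  shows "ennreal t * emeasure lborel A + ennreal s * emeasure lborel B \<le> emeasure lborel C"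
proof (rule ennreal_le_epsilon)
  fix e :: real assume e: "0 < e"
  have bA: "bdd_above A" and bB: "bdd_below B"
    using bdd by (auto intro: bounded_imp_bdd_above bounded_imp_bdd_below)
  obtain a where a: "a \<in> A" "Sup A - e < a"
    using less_cSup_iff[OF ne(1) bA, of "Sup A - e"] e by auto
  obtain b where b: "b \<in> B" "b < Inf B + e"
    using cInf_less_iff[OF ne(2) bB, of "Inf B + e"] e by auto
  define P where "P = (\<lambda>x. (x - s * b) / t) -` A"
  define Q where "Q = (\<lambda>x. (x - t * a) / s) -` B"
  have mP: "P \<in> sets borel"
    unfolding P_def using measurable_sets[of "\<lambda>x. (x - s * b) / t" borel borel A] meas(1) by simp
  have mQ: "Q \<in> sets borel"
    unfolding Q_def using measurable_sets[of "\<lambda>x. (x - t * a) / s" borel borel B] meas(2) by simp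
  have scale: "emeasure lborel ((\<lambda>x. (x - k) / r) -` S) = ennreal r * emeasure lborel S"
    if r: "0 < r" and S: "S \<in> sets borel" for r k :: real and S
  proof -
    have m: "(\<lambda>x. (x - k) / r) -` S \<in> sets borel"
      using measurable_sets[of "\<lambda>x. (x - k) / r" borel borel S] S by simp
    have eq: "(\<lambda>x. k + r * x) -` ((\<lambda>x. (x - k) / r) -` S) = S"
      using r by auto
    have "emeasure lborel ((\<lambda>x. (x - k) / r) -` S)
        = \<bar>r\<bar> * emeasure (distr lborel borel (\<lambda>x. k + r * x)) ((\<lambda>x. (x - k) / r) -` S)"
      by (subst lborel_real_affine[of r k], use r in simp, subst emeasure_density)
         (use m in \<open>auto simp: nn_integral_cmult\<close>)
    also have "\<dots> = ennreal r * emeasure lborel S"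
      using r m by (simp add: emeasure_distr eq)
    finally show ?thesis .
  qed
  have eP: "emeasure lborel P = ennreal t * emeasure lborel A"
    unfolding P_def by (rule scale) (use t meas in auto)
  have eQ: "emeasure lborel Q = ennreal s * emeasure lborel B"
    unfolding Q_def by (rule scale) (use t meas in auto)
  have PC: "P \<union> Q \<subseteq> C"
  proof
    fix x assume "x \<in> P \<union> Q"
    then show "x \<in> C"
      using sub[of "(x - s * b) / t" b] sub[of a "(x - t * a) / s"] a b t
      by (auto simp: P_def Q_def)
  qed
  have inter: "P \<inter> Q \<subseteq> {t * a + s * Inf B .. t * Sup A + s * b}"
  proof
    fix x assume "x \<in> P \<inter> Q"
    then have "(x - s * b) / t \<le> Sup A" "Inf B \<le> (x - t * a) / s"
      by (auto simp: P_def Q_def intro!: cSup_upper cInf_lower bA bB)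
    then show "x \<in> {t * a + s * Inf B .. t * Sup A + s * b}"
      using t by (auto simp: field_simps)
  qed
  have "emeasure lborel (P \<inter> Q) \<le> emeasure lborel {t * a + s * Inf B .. t * Sup A + s * b}"
    by (rule emeasure_mono[OF inter]) simp
  also have "\<dots> \<le> ennreal e"
  proof -
    have "t * (Sup A - a) \<le> t * e" "s * (b - Inf B) \<le> s * e"
      using a b t by (auto intro!: mult_left_mono)
    moreover have "t * e + s * e = e" using t by (metis distrib_right mult_1)
    ultimately have "(t * Sup A + s * b) - (t * a + s * Inf B) \<le> e"
      by (simp add: algebra_simps)
    then show ?thesis by (simp add: emeasure_lborel_Icc_eq ennreal_leI)
  qed
  finally have I: "emeasure lborel (P \<inter> Q) \<le> ennreal e" .
  have "emeasure lborel P + emeasure lborel Q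
      = emeasure lborel (P \<union> Q) + emeasure lborel (P \<inter> Q)"
    using mP mQ I by (intro emeasure_Un_Int) auto
  also have "\<dots> \<le> emeasure lborel C + ennreal e"
    by (intro add_mono I emeasure_mono PC) (use meas in auto)
  finally show "ennreal t * emeasure lborel A + ennreal s * emeasure lborel B
      \<le> emeasure lborel C + ennreal e"
    by (simp add: eP eQ)
qed

lemma brunn_minkowski_real:
  fixes A B C :: "real set"
  assumes t: "0 < t" "0 < s" "t + s = (1::real)"
    and meas: "A \<in> sets borel" "B \<in> sets borel" "C \<in> sets borel"
    and ne: "A \<noteq> {}" "B \<noteq> {}"
    and sub: "\<And>a b. a \<in> A \<Longrightarrow> b \<in> B \<Longrightarrow> t * a + s * b \<in> C"
  shows "ennreal t * emeasure lborel A + ennreal s * emeasure lborel B \<le> emeasure lborel C"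
proof -
  have lim: "(\<lambda>k. emeasure lborel (S \<inter> {-real k..real k})) \<longlonglongrightarrow> emeasure lborel S"
    if S: "S \<in> sets borel" for S
  proof -
    have "(\<lambda>k. emeasure lborel (S \<inter> {-real k..real k}))
        \<longlonglongrightarrow> emeasure lborel (\<Union>k. S \<inter> {-real k..real k})"
      using S by (intro Lim_emeasure_incseq) (auto simp: incseq_def)
    moreover have "(\<Union>k. S \<inter> {-real k..real k}) = S"
    proof -
      have "\<exists>k. - real k \<le> x \<and> x \<le> real k" for x
        using real_arch_simple[of "\<bar>x\<bar>"] by (auto simp: abs_le_iff minus_le_iff)
      then show ?thesis by auto
    qed
    ultimately show ?thesis by simp
  qed
  obtain a b where ab: "a \<in> A" "b \<in> B" using ne by auto
  obtain k0 where k0: "\<bar>a\<bar> + \<bar>b\<bar> \<le> real k0" using real_arch_simple by blast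
  have ev: "\<forall>k\<ge>k0. ennreal t * emeasure lborel (A \<inter> {-real k..real k})
      + ennreal s * emeasure lborel (B \<inter> {-real k..real k}) \<le> emeasure lborel C"
  proof (intro allI impI)
    fix k assume "k0 \<le> k"
    then have "real k0 \<le> real k" by simp
    then have in_k: "a \<in> A \<inter> {-real k..real k}" "b \<in> B \<inter> {-real k..real k}" 
      using ab k0 by auto
    show "ennreal t * emeasure lborel (A \<inter> {-real k..real k})
      + ennreal s * emeasure lborel (B \<inter> {-real k..real k}) \<le> emeasure lborel C"
      by (rule brunn_minkowski_bounded[OF t])
         (use meas in_k sub in \<open>auto intro: bounded_subset[OF bounded_closed_interval]\<close>)
  qed
  have "(\<lambda>k. ennreal t * emeasure lborel (A \<inter> {-real k..real k})
      + ennreal s * emeasure lborel (B \<inter> {-real k..real k}))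
      \<longlonglongrightarrow> ennreal t * emeasure lborel A + ennreal s * emeasure lborel B"
    using meas by (intro tendsto_add tendsto_mult_ennreal lim tendsto_const) (use t in auto)
  then show ?thesis by (rule LIMSEQ_le_const2) (use ev in blast)
qed

lemma layer_cake_unit:
  fixes u :: "real \<Rightarrow> real"
  assumes [measurable]: "u \<in> borel_measurable borel"
    and u: "\<And>x. 0 \<le> u x" "\<And>x. u x \<le> 1"
  shows "(\<integral>\<^sup>+x. ennreal (u x) \<partial>lborel)
    = (\<integral>\<^sup>+l. emeasure lborel {x. l < u x} * indicator {0<..<1} l \<partial>lborel)"
proof -
  have "(\<integral>\<^sup>+x. ennreal (u x) \<partial>lborel)
      = (\<integral>\<^sup>+x. (\<integral>\<^sup>+l. indicator {l. 0 < l \<and> l < 1 \<and> l < u x} l \<partial>lborel) \<partial>lborel)"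
  proof (rule nn_integral_cong)
    fix x
    have "emeasure lborel {l. 0 < l \<and> l < 1 \<and> l < u x} = emeasure lborel {0<..<u x}"
      using u by (intro arg_cong[where f = "emeasure lborel"]) (force simp: less_le_trans)
    then show "ennreal (u x)
        = (\<integral>\<^sup>+l. indicator {l. 0 < l \<and> l < 1 \<and> l < u x} l \<partial>lborel)"
      using u by (subst nn_integral_indicator) auto
  qed
  also have "\<dots> = (\<integral>\<^sup>+l. (\<integral>\<^sup>+x. indicator {l. 0 < l \<and> l < 1 \<and> l < u x} l \<partial>lborel) \<partial>lborel)"
    by (rule lborel_pair.Fubini') measurable
  also have "\<dots> = (\<integral>\<^sup>+l. emeasure lborel {x. l < u x} * indicator {0<..<1} l \<partial>lborel)"
  proof (rule nn_integral_cong)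
    fix l :: real
    have "(\<integral>\<^sup>+x. indicator {l. 0 < l \<and> l < 1 \<and> l < u x} l \<partial>lborel)
        = (\<integral>\<^sup>+x. indicator {0<..<1} l * indicator {x. l < u x} x \<partial>lborel)"
      by (intro nn_integral_cong) (auto split: split_indicator)
    also have "\<dots> = emeasure lborel {x. l < u x} * indicator {0<..<1} l"
      by (subst nn_integral_cmult) (auto simp: mult.commute)
    finally show "(\<integral>\<^sup>+x. indicator {l. 0 < l \<and> l < 1 \<and> l < u x} l \<partial>lborel)
        = emeasure lborel {x. l < u x} * indicator {0<..<1} l" .
  qed
  finally show ?thesis .
qed

section \<open>The Prekopa-Leindler inequality\<close>

text \<open>
  Add up \<open>m\<close> copies of the tangent inequality for \<open>ln\<close> at the weighted mean, applied to \<open>x\<close>,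
  and one copy applied to \<open>y\<close>.
\<close>

lemma weighted_am_gm:
  fixes x y :: real
  assumes "0 \<le> x" "0 \<le> y" "0 < m"
  shows "x ^ m * y \<le> ((real m * x + y) / (real m + 1)) ^ (m + 1)"
proof (cases "x = 0 \<or> y = 0")
  case True
  then have "x ^ m * y = 0" using assms by (auto simp: zero_power)
  then show ?thesis using assms by (metis add_nonneg_nonneg divide_nonneg_nonneg mult_nonneg_nonneg of_nat_0_le_iff zero_le_one zero_le_power)
next
  case False
  with assms have pos: "0 < x" "0 < y" by auto
  define a where "a = (real m * x + y) / (real m + 1)"
  have a: "0 < a" unfolding a_def using pos by (intro divide_pos_pos add_nonneg_pos) auto
  have tangent: "ln r \<le> ln a + (r / a - 1)" if "0 < r" for r
    using ln_le_minus_one[of "r / a"] that a by (simp add: ln_div)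
  have "real m * ln x + ln y \<le> real m * (ln a + (x / a - 1)) + (ln a + (y / a - 1))"
    using tangent pos by (intro add_mono mult_left_mono) auto
  also have "\<dots> = (real m + 1) * ln a + ((real m * x + y) / a - (real m + 1))"
    using a by (simp add: field_simps)
  also have "(real m * x + y) / a = real m + 1"
    using a unfolding a_def by (simp add: field_simps)
  finally have "ln (x ^ m * y) \<le> ln (a ^ (m + 1))"
    using pos a by (simp add: ln_mult ln_realpow algebra_simps)
  then have "x ^ m * y \<le> a ^ (m + 1)"
    using pos a by (subst (asm) ln_le_cancel_iff) auto
  then show ?thesis by (simp add: a_def)
qed

text \<open>
  When both functions have supremum exactly 1, all their level sets at heights in \<open>(0, 1)\<close> are
  nonempty, so Brunn-Minkowski applies at every height; integrating over the heights gives an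
  \<^emph>\<open>additive\<close> bound. The multiplicative form follows later from the weighted AM-GM inequality.
\<close>

lemma prekopa_leindler_normalised:
  fixes u v :: "real \<Rightarrow> real" and w :: "real \<Rightarrow> ennreal"
  assumes t: "0 < t" "0 < s" "t + s = (1::real)"
    and [measurable]: "u \<in> borel_measurable borel" "v \<in> borel_measurable borel"
      "w \<in> borel_measurable borel"
    and u: "\<And>x. 0 \<le> u x" "\<And>x. u x \<le> 1" "\<And>l. l < 1 \<Longrightarrow> \<exists>x. l < u x"
    and v: "\<And>x. 0 \<le> v x" "\<And>x. v x \<le> 1" "\<And>l. l < 1 \<Longrightarrow> \<exists>x. l < v x"
    and w: "\<And>l x y. 0 < l \<Longrightarrow> l < 1 \<Longrightarrow> l < u x \<Longrightarrow> l < v y \<Longrightarrow> ennreal l < w (t * x + s * y)"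
  shows "ennreal t * (\<integral>\<^sup>+x. ennreal (u x) \<partial>lborel) + ennreal s * (\<integral>\<^sup>+x. ennreal (v x) \<partial>lborel)
    \<le> (\<integral>\<^sup>+x. w x \<partial>lborel)"
proof -
  define w' where "w' x = enn2real (min 1 (w x))" for x
  have [measurable]: "w' \<in> borel_measurable borel" unfolding w'_def by measurable
  have w'_eq: "ennreal (w' x) = min 1 (w x)" for x
    unfolding w'_def by (rule ennreal_enn2real) (auto simp: min_less_iff_disj)
  have w'_le: "w' x \<le> 1" for x
    by (metis w'_eq ennreal_le_1 min.cobounded1)
  have w'_ge: "0 \<le> w' x" for x by (simp add: w'_def)
  have level: "ennreal t * emeasure lborel {x. l < u x} + ennreal s * emeasure lborel {x. l < v x}
      \<le> emeasure lborel {x. l < w' x}" if l: "0 < l" "l < 1" for l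
  proof (rule brunn_minkowski_real[OF t])
    fix x y assume "x \<in> {x. l < u x}" "y \<in> {x. l < v x}"
    then have "ennreal l < w (t * x + s * y)" using w l by simp
    then have "ennreal l < ennreal (w' (t * x + s * y))"
      using l by (simp add: w'_eq)
    then show "t * x + s * y \<in> {x. l < w' x}"
      using l by (simp add: ennreal_less_iff)
  qed (use u v l in auto)
  have "ennreal t * (\<integral>\<^sup>+x. ennreal (u x) \<partial>lborel) + ennreal s * (\<integral>\<^sup>+x. ennreal (v x) \<partial>lborel)
    = (\<integral>\<^sup>+l. (ennreal t * emeasure lborel {x. l < u x} + ennreal s * emeasure lborel {x. l < v x})
        * indicator {0<..<1} l \<partial>lborel)"
    by (simp add: layer_cake_unit u v distrib_right mult.assoc nn_integral_add nn_integral_cmult)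
  also have "\<dots> \<le> (\<integral>\<^sup>+l. emeasure lborel {x. l < w' x} * indicator {0<..<1} l \<partial>lborel)"
    by (intro nn_integral_mono) (auto split: split_indicator intro: level)
  also have "\<dots> = (\<integral>\<^sup>+x. ennreal (w' x) \<partial>lborel)"
    by (simp add: layer_cake_unit w'_le w'_ge)
  also have "\<dots> \<le> (\<integral>\<^sup>+x. w x \<partial>lborel)"
    by (intro nn_integral_mono) (simp add: w'_eq)
  finally show ?thesis .
qed

text \<open>
  In the Prekopa-Leindler inequalities below the weights are \<open>m / (m + 1)\<close> and \<open>1 / (m + 1)\<close>
  with \<open>m\<close> a natural number, and both sides are raised to the power \<open>m + 1\<close>. Only natural powers
  then occur, which make sense for infinite values as well; and these weights suffice for
  the limit \<open>m \<rightarrow> \<infinity>\<close> from which the logarithmic Sobolev inequality comes.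

  Bounded functions are reduced to supremum 1 by dividing \<open>u\<close> and \<open>v\<close> by their suprema and \<open>w\<close>
  by the matching constant \<open>c\<close>.
\<close>

lemma prekopa_leindler_bounded:
  fixes u v :: "real \<Rightarrow> real" and w :: "real \<Rightarrow> ennreal"
  assumes m: "0 < m"
    and [measurable]: "u \<in> borel_measurable borel" "v \<in> borel_measurable borel"
      "w \<in> borel_measurable borel"
    and u: "\<And>x. 0 \<le> u x" "bdd_above (range u)"
    and v: "\<And>x. 0 \<le> v x" "bdd_above (range v)"
    and w: "\<And>x y. ennreal (u x) ^ m * ennreal (v y) \<le> w ((real m * x + y) / (real m + 1)) ^ (m + 1)"
  shows "(\<integral>\<^sup>+x. ennreal (u x) \<partial>lborel) ^ m * (\<integral>\<^sup>+x. ennreal (v x) \<partial>lborel)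
    \<le> (\<integral>\<^sup>+x. w x \<partial>lborel) ^ (m + 1)"
proof -
  define M N where "M = (SUP x. u x)" and "N = (SUP x. v x)"
  have uM: "u x \<le> M" for x unfolding M_def using u by (intro cSUP_upper) auto
  have vN: "v x \<le> N" for x unfolding N_def using v by (intro cSUP_upper) auto
  have "0 \<le> M" "0 \<le> N" using uM[of 0] vN[of 0] u(1)[of 0] v(1)[of 0] by auto
  show ?thesis
  proof (cases "M = 0 \<or> N = 0")
    case True
    then have "(\<forall>x. u x = 0) \<or> (\<forall>x. v x = 0)"
      using uM vN u v by (metis order_antisym)
    then show ?thesis using m by (auto simp: zero_power)
  next
    case False
    with \<open>0 \<le> M\<close> \<open>0 \<le> N\<close> have MN: "0 < M" "0 < N" by auto
    define c where "c = root (m + 1) (M ^ m * N)"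
    have c: "0 < c" "c ^ (m + 1) = M ^ m * N"
      using MN unfolding c_def by (auto simp del: power_Suc)
    define t s where "t = real m / (real m + 1)" and "s = 1 / (real m + 1)"
    have ts: "0 < t" "0 < s" "t + s = 1"
      using m by (auto simp: t_def s_def field_simps)
    define U V where "U = (\<integral>\<^sup>+x. ennreal (u x / M) \<partial>lborel)" and "V = (\<integral>\<^sup>+x. ennreal (v x / N) \<partial>lborel)"
    define I where "I = (\<integral>\<^sup>+x. w x / ennreal c \<partial>lborel)"
    have unscale: "ennreal c * (a / ennreal c) = a" for a
      using c(1) by (simp add: ennreal_times_divide mult.commute[of _ a] ennreal_mult_divide_eq)
    have scale: "(\<integral>\<^sup>+x. ennreal (u x) \<partial>lborel) = ennreal M * U"
      "(\<integral>\<^sup>+x. ennreal (v x) \<partial>lborel) = ennreal N * V"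
      "(\<integral>\<^sup>+x. w x \<partial>lborel) = ennreal c * I"
      using MN c(1) u v unfolding U_def V_def I_def
      by (auto simp: nn_integral_cmult[symmetric] ennreal_mult[symmetric] unscale
          intro!: nn_integral_cong)
    have main: "ennreal t * U + ennreal s * V \<le> I"
      unfolding U_def V_def I_def
      \<comment> \<open>As \<open>c ^ (m + 1) = M ^ m * N\<close>, the bounds \<open>u x > l M\<close> and \<open>v y > l N\<close> force \<open>w > l c\<close>.\<close>
    proof (rule prekopa_leindler_normalised[OF ts])
      fix l x y :: real assume l: "0 < l" "l < 1" "l < u x / M" "l < v y / N"
      then have lt: "l * M < u x" "l * N < v y" using MN by (auto simp: field_simps)
      have "0 < u x" using lt(1) l MN by (meson mult_pos_pos less_trans)
      have "(l * c) ^ (m + 1) = (l * M) ^ m * (l * N)"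
        using c(2) by (simp add: power_mult_distrib)
      also have "\<dots> < u x ^ m * v y"
        using lt l MN m \<open>0 < u x\<close> by (intro mult_strict_mono power_strict_mono) auto
      finally have "ennreal (l * c) ^ (m + 1) < ennreal (u x) ^ m * ennreal (v y)"
        using l c(1) u(1) v(1) MN
        by (simp add: ennreal_power ennreal_mult[symmetric] ennreal_less_iff del: power_Suc)
      also have "\<dots> \<le> w (t * x + s * y) ^ (m + 1)"
        using w[of x y] by (simp add: t_def s_def add_divide_distrib)
      finally have "ennreal (l * c) < w (t * x + s * y)"
        by (meson linorder_not_less power_mono zero_le)
      then have "ennreal c * ennreal l < ennreal c * (w (t * x + s * y) / ennreal c)"
        using c(1) l by (simp add: unscale ennreal_mult mult.commute)
      then show "ennreal l < w (t * x + s * y) / ennreal c"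
        by (meson linorder_not_less mult_left_mono zero_le)
    next
      show "\<exists>x. l < u x / M" if "l < 1" for l
      proof -
        have "l * M < M" using that MN by simp
        then show ?thesis
          using less_cSUP_iff[of UNIV u "l * M"] u MN unfolding M_def[symmetric]
          by (auto simp: field_simps)
      qed
      show "\<exists>x. l < v x / N" if "l < 1" for l
      proof -
        have "l * N < N" using that MN by simp
        then show ?thesis
          using less_cSUP_iff[of UNIV v "l * N"] v MN unfolding N_def[symmetric]
          by (auto simp: field_simps)
      qed
    qed (use u v uM vN MN in \<open>auto simp: field_simps\<close>)
    have "U ^ m * V \<le> I ^ (m + 1)"
    proof (cases "U = \<top> \<or> V = \<top>")
      case True
      then have "I = \<top>" using main ts by (auto simp: ennreal_mult_top top_unique ennreal_mult_eq_top_iff)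
      then show ?thesis by (simp add: ennreal_top_mult)
    next
      case False
      then obtain a b where ab: "U = ennreal a" "V = ennreal b" "0 \<le> a" "0 \<le> b"
        by (metis ennreal_cases)
      have "U ^ m * V = ennreal (a ^ m * b)"
        using ab by (simp add: ennreal_power ennreal_mult)
      also have "\<dots> \<le> ennreal ((t * a + s * b) ^ (m + 1))"
        using weighted_am_gm[OF ab(3,4) m]
        by (intro ennreal_leI) (simp add: t_def s_def add_divide_distrib)
      also have "\<dots> = (ennreal t * U + ennreal s * V) ^ (m + 1)"
        using ab ts by (simp add: ennreal_power ennreal_mult[symmetric] ennreal_plus[symmetric] del: power_Suc ennreal_plus)
      also have "\<dots> \<le> I ^ (m + 1)" using main by (rule power_mono) simp
      finally show ?thesis .
    qed
    then have "(ennreal M ^ m * ennreal N) * (U ^ m * V) \<le> (ennreal M ^ m * ennreal N) * I ^ (m + 1)"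
      by (rule mult_left_mono) simp
    also have "ennreal M ^ m * ennreal N = ennreal c ^ (m + 1)"
      using c MN by (simp add: ennreal_power ennreal_mult[symmetric] del: power_Suc)
    also have "ennreal c ^ (m + 1) * I ^ (m + 1) = (ennreal c * I) ^ (m + 1)"
      by (simp only: power_mult_distrib)
    also have "ennreal c ^ (m + 1) * (U ^ m * V) = (ennreal M * U) ^ m * (ennreal N * V)"
      unfolding \<open>ennreal M ^ m * ennreal N = ennreal c ^ (m + 1)\<close>[symmetric]
      by (simp add: power_mult_distrib mult_ac)
    finally show ?thesis unfolding scale .
  qed
qed

text \<open>
  The values may be infinite, since the induction on the dimension applies this lemma to
  marginals, about whose finiteness nothing is known. Truncation at height \<open>k\<close> reduces to the
  bounded case.
\<close>

lemma prekopa_leindler_line: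
  fixes u v w :: "real \<Rightarrow> ennreal"
  assumes m: "0 < m"
    and [measurable]: "u \<in> borel_measurable borel" "v \<in> borel_measurable borel"
      "w \<in> borel_measurable borel"
    and w: "\<And>x y. u x ^ m * v y \<le> w ((real m * x + y) / (real m + 1)) ^ (m + 1)"
  shows "(\<integral>\<^sup>+x. u x \<partial>lborel) ^ m * (\<integral>\<^sup>+x. v x \<partial>lborel) \<le> (\<integral>\<^sup>+x. w x \<partial>lborel) ^ (m + 1)"
proof -
  define tr where "tr k a = min (of_nat k) (a :: ennreal)" for k a
  have fin: "tr k a < \<top>" for k a
    unfolding tr_def by (simp add: min_less_iff_disj of_nat_less_top)
  have sup: "(SUP k. tr k a) = a" for a
  proof (rule antisym)
    show "(SUP k. tr k a) \<le> a" by (auto simp: tr_def intro: SUP_least)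
    show "a \<le> (SUP k. tr k a)"
    proof (cases "a = \<top>")
      case True
      then show ?thesis by (simp add: tr_def ennreal_SUP_of_nat_eq_top)
    next
      case False
      then obtain k where "a < of_nat k" using ennreal_Ex_less_of_nat[of a] by (auto simp: less_top)
      then have "tr k a = a" by (simp add: tr_def min_absorb2)
      then show ?thesis by (metis SUP_upper UNIV_I)
    qed
  qed
  have tr_mono: "incseq (\<lambda>k x. tr k (f x))" for f :: "real \<Rightarrow> ennreal"
    by (auto simp: incseq_def le_fun_def tr_def min_le_iff_disj intro!: min.mono)
  have [measurable]: "tr k \<in> borel_measurable borel" for k unfolding tr_def by measurable
  have step: "(\<integral>\<^sup>+x. tr k (u x) \<partial>lborel) ^ m * (\<integral>\<^sup>+x. tr k (v x) \<partial>lborel) \<le> (\<integral>\<^sup>+x. w x \<partial>lborel) ^ (m + 1)" for k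
  proof -
    have tr_real: "ennreal (enn2real (tr k a)) = tr k a" for a
      using fin by simp
    have bd: "enn2real (tr k a) \<le> real k" for a
      by (rule enn2real_leI) (auto simp: tr_def ennreal_of_nat_eq_real_of_nat)
    have "(\<integral>\<^sup>+x. ennreal (enn2real (tr k (u x))) \<partial>lborel) ^ m * (\<integral>\<^sup>+x. ennreal (enn2real (tr k (v x))) \<partial>lborel)
        \<le> (\<integral>\<^sup>+x. w x \<partial>lborel) ^ (m + 1)"
    proof (rule prekopa_leindler_bounded[OF m])
      fix x y
      have "tr k (u x) ^ m * tr k (v y) \<le> u x ^ m * v y"
        by (intro mult_mono power_mono) (auto simp: tr_def)
      then show "ennreal (enn2real (tr k (u x))) ^ m * ennreal (enn2real (tr k (v y)))
          \<le> w ((real m * x + y) / (real m + 1)) ^ (m + 1)"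
        unfolding tr_real using w order_trans by blast
    qed (use bd in \<open>auto intro!: bdd_aboveI2\<close>)
    then show ?thesis unfolding tr_real .
  qed
  have conv: "(\<lambda>k. \<integral>\<^sup>+x. tr k (f x) \<partial>lborel) \<longlonglongrightarrow> (\<integral>\<^sup>+x. f x \<partial>lborel)"
    and inc: "incseq (\<lambda>k. \<integral>\<^sup>+x. tr k (f x) \<partial>lborel)"
    if [measurable]: "f \<in> borel_measurable borel" for f :: "real \<Rightarrow> ennreal"
  proof -
    show inc: "incseq (\<lambda>k. \<integral>\<^sup>+x. tr k (f x) \<partial>lborel)"
      using tr_mono[of f] by (auto simp: incseq_def le_fun_def intro!: nn_integral_mono)
    have "(\<integral>\<^sup>+x. (SUP k. tr k (f x)) \<partial>lborel) = (SUP k. \<integral>\<^sup>+x. tr k (f x) \<partial>lborel)"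
      by (rule nn_integral_monotone_convergence_SUP[OF tr_mono]) measurable
    then have "(SUP k. \<integral>\<^sup>+x. tr k (f x) \<partial>lborel) = (\<integral>\<^sup>+x. f x \<partial>lborel)"
      by (simp add: sup)
    then show "(\<lambda>k. \<integral>\<^sup>+x. tr k (f x) \<partial>lborel) \<longlonglongrightarrow> (\<integral>\<^sup>+x. f x \<partial>lborel)"
      using LIMSEQ_SUP[OF inc] by simp
  qed
  define U V where "U = (\<integral>\<^sup>+x. u x \<partial>lborel)" and "V = (\<integral>\<^sup>+x. v x \<partial>lborel)"
  have cu: "(\<lambda>k. \<integral>\<^sup>+x. tr k (u x) \<partial>lborel) \<longlonglongrightarrow> U" and cv: "(\<lambda>k. \<integral>\<^sup>+x. tr k (v x) \<partial>lborel) \<longlonglongrightarrow> V"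
    unfolding U_def V_def by (auto intro: conv)
  show ?thesis
  proof (cases "U = 0 \<or> V = 0")
    case True
    then show ?thesis using m by (auto simp: U_def[symmetric] V_def[symmetric] zero_power)
  next
    case False
    have cp: "(\<lambda>k. (\<integral>\<^sup>+x. tr k (u x) \<partial>lborel) ^ j) \<longlonglongrightarrow> U ^ j" for j
    proof (induction j)
      case (Suc j)
      then show ?case using False cu by (auto intro!: tendsto_mult_ennreal)
    qed simp
    have "(\<lambda>k. (\<integral>\<^sup>+x. tr k (u x) \<partial>lborel) ^ m * (\<integral>\<^sup>+x. tr k (v x) \<partial>lborel)) \<longlonglongrightarrow> U ^ m * V"
      using False by (intro tendsto_mult_ennreal cp cv) auto
    then have "U ^ m * V \<le> (\<integral>\<^sup>+x. w x \<partial>lborel) ^ (m + 1)"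
      by (rule LIMSEQ_le_const2) (use step in blast)
    then show ?thesis by (simp add: U_def V_def)
  qed
qed

text \<open>
  Fix the last coordinates \<open>a\<close> and \<open>b\<close> of the two points. The induction hypothesis for the
  sections says that the marginals in the last coordinate satisfy the hypothesis of the inequality
  on the line.
\<close>

lemma prekopa_leindler:
  fixes u v w :: "(nat \<Rightarrow> real) \<Rightarrow> ennreal"
  assumes m: "0 < m"
    and "u \<in> borel_measurable (Pi\<^sub>M {..<d} (\<lambda>_. lborel))"
      "v \<in> borel_measurable (Pi\<^sub>M {..<d} (\<lambda>_. lborel))"
      "w \<in> borel_measurable (Pi\<^sub>M {..<d} (\<lambda>_. lborel))"
    and "\<And>x y. x \<in> {..<d} \<rightarrow>\<^sub>E UNIV \<Longrightarrow> y \<in> {..<d} \<rightarrow>\<^sub>E UNIV \<Longrightarrow>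
      u x ^ m * v y \<le> w (\<lambda>i\<in>{..<d}. (real m * x i + y i) / (real m + 1)) ^ (m + 1)"
  shows "(\<integral>\<^sup>+x. u x \<partial>Pi\<^sub>M {..<d} (\<lambda>_. lborel)) ^ m * (\<integral>\<^sup>+x. v x \<partial>Pi\<^sub>M {..<d} (\<lambda>_. lborel))
    \<le> (\<integral>\<^sup>+x. w x \<partial>Pi\<^sub>M {..<d} (\<lambda>_. lborel)) ^ (m + 1)"
  using assms(2-)
proof (induction d arbitrary: u v w)
  case 0
  interpret product_sigma_finite "\<lambda>_::nat. lborel :: real measure" ..
  have "\<integral>\<^sup>+x. h x \<partial>Pi\<^sub>M {} (\<lambda>_. lborel) = h (\<lambda>_. undefined)" for h :: "(nat \<Rightarrow> real) \<Rightarrow> ennreal"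
    by (subst PiM_empty) (simp add: nn_integral_count_space_finite)
  then show ?case using "0.prems"(4)[of "\<lambda>_. undefined" "\<lambda>_. undefined"]
    by (simp add: restrict_def)
next
  case (Suc d)
  interpret product_sigma_finite "\<lambda>_::nat. lborel :: real measure" ..
  let ?L = "Pi\<^sub>M {..<d} (\<lambda>_. lborel :: real measure)"
  have split: "(\<integral>\<^sup>+x. h x \<partial>Pi\<^sub>M {..<Suc d} (\<lambda>_. lborel)) = (\<integral>\<^sup>+r. (\<integral>\<^sup>+x. h (x(d := r)) \<partial>?L) \<partial>lborel)"
    if "h \<in> borel_measurable (Pi\<^sub>M {..<Suc d} (\<lambda>_. lborel))" for h :: "(nat \<Rightarrow> real) \<Rightarrow> ennreal"
    unfolding lessThan_Suc by (rule product_nn_integral_insert_rev) (use that in \<open>auto simp: lessThan_Suc\<close>)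
  have sect [measurable]: "(\<lambda>x. h (x(d := r))) \<in> borel_measurable ?L"
    if "h \<in> borel_measurable (Pi\<^sub>M {..<Suc d} (\<lambda>_. lborel))" for h :: "(nat \<Rightarrow> real) \<Rightarrow> ennreal" and r
    by (rule measurable_compose[OF _ that]) (simp add: lessThan_Suc measurable_fun_upd[where J = "{..<d}"])
  interpret L: sigma_finite_measure ?L
    by (rule sigma_finite) simp
  have marg [measurable]: "(\<lambda>r. \<integral>\<^sup>+x. h (x(d := r)) \<partial>?L) \<in> borel_measurable borel"
    if "h \<in> borel_measurable (Pi\<^sub>M {..<Suc d} (\<lambda>_. lborel))" for h :: "(nat \<Rightarrow> real) \<Rightarrow> ennreal"
  proof -
    have "(\<lambda>(r, x). h (x(d := r))) \<in> borel_measurable (lborel \<Otimes>\<^sub>M ?L)"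
      unfolding split_beta
      by (rule measurable_compose[OF _ that])
         (simp add: lessThan_Suc measurable_fun_upd[where J = "{..<d}"])
    then have "(\<lambda>r. \<integral>\<^sup>+x. h (x(d := r)) \<partial>?L) \<in> borel_measurable lborel"
      by (rule L.borel_measurable_nn_integral)
    then show ?thesis by simp
  qed
  show ?case unfolding split[OF Suc.prems(1)] split[OF Suc.prems(2)] split[OF Suc.prems(3)]
  proof (rule prekopa_leindler_line[OF m])
    fix a b :: real
    show "(\<integral>\<^sup>+x. u (x(d := a)) \<partial>?L) ^ m * (\<integral>\<^sup>+x. v (x(d := b)) \<partial>?L)
      \<le> (\<integral>\<^sup>+x. w (x(d := (real m * a + b) / (real m + 1))) \<partial>?L) ^ (m + 1)"
    proof (rule Suc.IH)
      fix x y :: "nat \<Rightarrow> real" assume xy: "x \<in> {..<d} \<rightarrow>\<^sub>E UNIV" "y \<in> {..<d} \<rightarrow>\<^sub>E UNIV"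
      have eq: "(\<lambda>i\<in>{..<d}. (real m * x i + y i) / (real m + 1))(d := (real m * a + b) / (real m + 1))
        = (\<lambda>i\<in>{..<Suc d}. (real m * (x(d := a)) i + (y(d := b)) i) / (real m + 1))"
        by (auto simp: fun_eq_iff restrict_def)
      show "u (x(d := a)) ^ m * v (y(d := b))
        \<le> w ((\<lambda>i\<in>{..<d}. (real m * x i + y i) / (real m + 1))(d := (real m * a + b) / (real m + 1))) ^ (m + 1)"
        unfolding eq by (rule Suc.prems(4)) (use xy in \<open>auto simp: PiE_iff extensional_def\<close>)
    qed (intro sect Suc.prems)+
  qed (intro marg Suc.prems)+
qed

section \<open>From Prekopa-Leindler to the logarithmic Sobolev inequality\<close>

lemma space_lebesgue_measure_PiE: "space (lebesgue_measure d) = {..<d} \<rightarrow>\<^sub>E UNIV"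
  by (simp add: lebesgue_measure_def space_PiM)

lemma integral_pos_lebesgue_measure:
  fixes h :: "(nat \<Rightarrow> real) \<Rightarrow> real"
  assumes "integrable (lebesgue_measure d) h" "\<And>x. x \<in> {..<d} \<rightarrow>\<^sub>E UNIV \<Longrightarrow> 0 < h x"
  shows "0 < (LINT x|lebesgue_measure d. h x)"
proof (rule ccontr)
  interpret product_sigma_finite "\<lambda>_::nat. lborel :: real measure" ..
  let ?M = "lebesgue_measure d"
  have nn: "AE x in ?M. 0 \<le> h x"
    using assms(2) by (intro AE_I2 less_imp_le) (simp add: space_lebesgue_measure_PiE)
  assume "\<not> 0 < (LINT x|?M. h x)"
  moreover have "0 \<le> (LINT x|?M. h x)" by (rule integral_nonneg_AE[OF nn])
  ultimately have "(LINT x|?M. h x) = 0" by simp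
  then have "AE x in ?M. h x = 0"
    using integral_nonneg_eq_0_iff_AE[OF assms(1) nn] by simp
  then have "AE x in ?M. False"
    by (rule AE_mp) (use assms(2) in \<open>force intro!: AE_I2 simp: space_lebesgue_measure_PiE\<close>)
  then have "emeasure ?M (space ?M) = 0"
    by (simp add: AE_iff_measurable[OF sets.top])
  then show False
    unfolding lebesgue_measure_def by (simp add: space_PiM emeasure_PiM)
qed

lemma integrable_bounded_mult:
  fixes h p :: "'a \<Rightarrow> real"
  assumes "integrable M p" "h \<in> borel_measurable M" "\<And>x. x \<in> space M \<Longrightarrow> \<bar>h x\<bar> \<le> C"
  shows "integrable M (\<lambda>x. h x * p x)"
proof (rule Bochner_Integration.integrable_bound)
  show "integrable M (\<lambda>x. C * p x)" using assms(1) by simp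
  show "(\<lambda>x. h x * p x) \<in> borel_measurable M" using assms by measurable
  show "AE x in M. norm (h x * p x) \<le> norm (C * p x)"
  proof (rule AE_I2)
    fix x assume "x \<in> space M"
    then have "\<bar>h x\<bar> \<le> \<bar>C\<bar>" using assms(3)[of x] by linarith
    then show "norm (h x * p x) \<le> norm (C * p x)"
      by (simp add: abs_mult mult_right_mono)
  qed
qed

text \<open>
  The \<open>\<kappa>\<close>-convexity of a potential in its two-point form, which is what Prekopa-Leindler
  consumes and which makes sense for a potential that is not twice differentiable.
\<close>

definition strongly_convex :: "nat \<Rightarrow> real \<Rightarrow> ((nat \<Rightarrow> real) \<Rightarrow> real) \<Rightarrow> bool" where
  "strongly_convex d \<kappa> W \<longleftrightarrow>
     (\<forall>x\<in>{..<d} \<rightarrow>\<^sub>E UNIV. \<forall>y\<in>{..<d} \<rightarrow>\<^sub>E UNIV. \<forall>t\<in>{0..1}.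
        W (\<lambda>i\<in>{..<d}. t * x i + (1 - t) * y i) + \<kappa> / 2 * (t * (1 - t)) * (\<Sum>i<d. (x i - y i)\<^sup>2)
          \<le> t * W x + (1 - t) * W y)"

text \<open>
  Put \<open>z = (m x + y) / (m + 1)\<close>. Strong convexity of \<open>W\<close> pays for a Gaussian penalty
  \<open>\<kappa> m |x - z|\<^sup>2 / 2\<close>. The upper bound for \<open>g x\<close> in terms of \<open>g z\<close> contributes
  \<open>G z \<bullet> (x - z) + K |x - z|\<^sup>2\<close>, and maximising the linear term against what is left of the
  penalty costs exactly \<open>|G z|\<^sup>2 / (2 (\<kappa> m - 2 K))\<close>. This explicit majorant replaces the
  sup-convolution of \<open>g\<close>, whose measurability and expansion would have to be studied.
\<close>

lemma prekopa_leindler_exponential: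
  fixes W g :: "(nat \<Rightarrow> real) \<Rightarrow> real" and G :: "nat \<Rightarrow> (nat \<Rightarrow> real) \<Rightarrow> real"
  assumes m: "0 < m" "2 * K < \<kappa> * real m"
    and sc: "strongly_convex d \<kappa> W"
    and W[measurable]: "W \<in> borel_measurable (lebesgue_measure d)"
    and g[measurable]: "g \<in> borel_measurable (lebesgue_measure d)"
    and G[measurable]: "\<And>i. i < d \<Longrightarrow> G i \<in> borel_measurable (lebesgue_measure d)"
    and semi: "\<And>x z. x \<in> {..<d} \<rightarrow>\<^sub>E UNIV \<Longrightarrow> z \<in> {..<d} \<rightarrow>\<^sub>E UNIV \<Longrightarrow>
      g x \<le> g z + (\<Sum>i<d. G i z * (x i - z i)) + K * (\<Sum>i<d. (x i - z i)\<^sup>2)"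
  shows "(\<integral>\<^sup>+x. ennreal (exp ((1 + 1 / real m) * g x - W x)) \<partial>lebesgue_measure d) ^ m
      * (\<integral>\<^sup>+x. ennreal (exp (- W x)) \<partial>lebesgue_measure d)
    \<le> (\<integral>\<^sup>+x. ennreal (exp (g x + (\<Sum>i<d. (G i x)\<^sup>2) / (2 * (\<kappa> * real m - 2 * K)) - W x))
        \<partial>lebesgue_measure d) ^ (m + 1)"
  unfolding lebesgue_measure_def
proof (rule prekopa_leindler[OF m(1)])
  define \<theta> where "\<theta> = 1 / (2 * (\<kappa> * real m - 2 * K))"
  have \<theta>: "0 < \<theta>" "1 / (4 * \<theta>) = \<kappa> * real m / 2 - K"
    using m by (auto simp: \<theta>_def field_simps)
  fix x y :: "nat \<Rightarrow> real" assume xy: "x \<in> {..<d} \<rightarrow>\<^sub>E UNIV" "y \<in> {..<d} \<rightarrow>\<^sub>E UNIV"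
  define z where "z = (\<lambda>i\<in>{..<d}. (real m * x i + y i) / (real m + 1))"
  define q where "q = (\<Sum>i<d. (x i - z i)\<^sup>2)"
  define n where "n = real m + 1"
  have n: "0 < n" "real m = n - 1" by (auto simp: n_def)
  define t where "t = (n - 1) / n"
  have t: "0 \<le> t" "t \<le> 1" "1 - t = 1 / n" using n m by (auto simp: t_def field_simps)
  have z_t: "z = (\<lambda>i\<in>{..<d}. t * x i + (1 - t) * y i)"
    unfolding z_def t(3) unfolding t_def n(2)
    using n by (auto simp: restrict_def fun_eq_iff add_divide_distrib)
  have zS: "z \<in> {..<d} \<rightarrow>\<^sub>E UNIV" by (simp add: z_def)
  have diff: "x i - y i = n * (x i - z i)" if "i < d" for i
  proof -
    have "n * z i = (n - 1) * x i + y i"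
      using that n(1) unfolding z_def n_def by simp
    then show ?thesis by (simp add: algebra_simps)
  qed
  have "(\<Sum>i<d. (x i - y i)\<^sup>2) = (\<Sum>i<d. n\<^sup>2 * (x i - z i)\<^sup>2)"
    by (intro sum.cong) (auto simp: diff power_mult_distrib)
  then have q: "(\<Sum>i<d. (x i - y i)\<^sup>2) = n\<^sup>2 * q"
    by (simp add: q_def sum_distrib_left)
  have "W z + \<kappa> / 2 * (t * (1 - t)) * (n\<^sup>2 * q) \<le> t * W x + (1 - t) * W y"
    using sc xy t(1,2) unfolding strongly_convex_def z_t q[symmetric] by (simp only: atLeastAtMost_iff)
  moreover have "\<kappa> / 2 * (t * (1 - t)) * (n\<^sup>2 * q) = \<kappa> / 2 * (n - 1) * q"
    unfolding t(3) unfolding t_def using n by (simp add: field_simps power2_eq_square)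
  ultimately have conv: "W z + \<kappa> / 2 * real m * q \<le> t * W x + (1 - t) * W y"
    unfolding n(2) by linarith
  \<comment> \<open>\<open>\<theta>\<close> is chosen so that the quadratic terms use up the penalty left after absorbing \<open>K\<close>.\<close>
  have young: "G i z * (x i - z i) \<le> \<theta> * (G i z)\<^sup>2 + (1 / (4 * \<theta>)) * (x i - z i)\<^sup>2" for i
  proof -
    have "0 \<le> (2 * \<theta> * G i z - (x i - z i))\<^sup>2" by simp
    then have "4 * \<theta> * (G i z * (x i - z i)) \<le> 4 * \<theta> * (\<theta> * (G i z)\<^sup>2 + (1 / (4 * \<theta>)) * (x i - z i)\<^sup>2)"
      using \<theta>(1) by (simp add: power2_eq_square algebra_simps)
    then show ?thesis using \<theta>(1) by (subst (asm) mult_le_cancel_left_pos) auto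
  qed
  have "(\<Sum>i<d. G i z * (x i - z i)) \<le> \<theta> * (\<Sum>i<d. (G i z)\<^sup>2) + (\<kappa> * real m / 2 - K) * q"
    unfolding q_def \<theta>(2)[symmetric] sum_distrib_left sum.distrib[symmetric]
    by (intro sum_mono young)
  then have "g x \<le> g z + \<theta> * (\<Sum>i<d. (G i z)\<^sup>2) + \<kappa> / 2 * real m * q"
    using semi[OF xy(1) zS] unfolding q_def[symmetric] by (simp add: algebra_simps)
  with conv have "g x - (t * W x + (1 - t) * W y) \<le> g z + \<theta> * (\<Sum>i<d. (G i z)\<^sup>2) - W z"
    by linarith
  then have "n * (g x - (t * W x + (1 - t) * W y)) \<le> n * (g z + \<theta> * (\<Sum>i<d. (G i z)\<^sup>2) - W z)"
    using n(1) by (intro mult_left_mono) auto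
  moreover have "n * (g x - (t * W x + (1 - t) * W y)) = real m * ((1 + 1 / real m) * g x - W x) + - W y"
  proof -
    have "n * t = real m" unfolding t_def n(2) using n(1) by simp
    moreover have "n * (1 - t) = 1" unfolding t(3) using n(1) by simp
    moreover have "real m * (1 + 1 / real m) = n" unfolding n_def using m by (simp add: distrib_left)
    moreover have "n * (g x - (t * W x + (1 - t) * W y)) = n * g x - (n * t) * W x - (n * (1 - t)) * W y"
      by (simp add: algebra_simps)
    moreover have "real m * ((1 + 1 / real m) * g x - W x) = (real m * (1 + 1 / real m)) * g x - real m * W x"
      by (simp only: right_diff_distrib mult.assoc)
    ultimately show ?thesis by (simp only:)
  qed
  ultimately have "real m * ((1 + 1 / real m) * g x - W x) + - W y
      \<le> real (m + 1) * (g z + \<theta> * (\<Sum>i<d. (G i z)\<^sup>2) - W z)"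
    by (simp only: n_def of_nat_add of_nat_1)
  then have "exp ((1 + 1 / real m) * g x - W x) ^ m * exp (- W y)
      \<le> exp (g z + \<theta> * (\<Sum>i<d. (G i z)\<^sup>2) - W z) ^ (m + 1)"
    unfolding exp_of_nat_mult[symmetric] exp_add[symmetric] exp_le_cancel_iff .
  then show "ennreal (exp ((1 + 1 / real m) * g x - W x)) ^ m * ennreal (exp (- W y))
    \<le> ennreal (exp (g (\<lambda>i\<in>{..<d}. (real m * x i + y i) / (real m + 1)) +
       (\<Sum>i<d. (G i (\<lambda>i\<in>{..<d}. (real m * x i + y i) / (real m + 1)))\<^sup>2) / (2 * (\<kappa> * real m - 2 * K))
       - W (\<lambda>i\<in>{..<d}. (real m * x i + y i) / (real m + 1)))) ^ (m + 1)"
    unfolding z_def[symmetric]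
    by (simp add: ennreal_power ennreal_mult[symmetric] ennreal_leI \<theta>_def del: power_Suc)
qed (unfold lebesgue_measure_def[symmetric], measurable)

text \<open>
  Take logarithms in the preceding inequality and let \<open>m \<rightarrow> \<infinity>\<close>. By Jensen's inequality the first
  integral on the left is at least \<open>a exp (b / (a m))\<close>, where \<open>b\<close> is the integral of \<open>g exp g\<close>,
  and the integral on the right is \<open>a + D / (2 \<kappa> m)\<close> up to \<open>o(1 / m)\<close>. The leading
  terms \<open>m ln a\<close> cancel, and the terms of order 1 are the entropy on the left and the energy on
  the right. In terms of \<open>F = exp g\<close> the energy is the Fisher information of \<open>F\<close>.

  Nothing but the one-sided quadratic bound \<open>semi\<close> ties \<open>G\<close> to the gradient of \<open>g\<close>, and neither
  \<open>K\<close> nor the bounds \<open>C\<close> and \<open>\<Gamma>\<close> survive in the conclusion. They may therefore depend on the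
  dimension and on \<open>g\<close>.
\<close>

proposition log_sobolev_strongly_convex:
  fixes W g :: "(nat \<Rightarrow> real) \<Rightarrow> real" and G :: "nat \<Rightarrow> (nat \<Rightarrow> real) \<Rightarrow> real"
  assumes \<kappa>: "0 < \<kappa>"
    and sc: "strongly_convex d \<kappa> W"
    and W[measurable]: "W \<in> borel_measurable (lebesgue_measure d)"
    and int: "integrable (lebesgue_measure d) (\<lambda>x. exp (- W x))"
    and g[measurable]: "g \<in> borel_measurable (lebesgue_measure d)"
    and G[measurable]: "\<And>i. i < d \<Longrightarrow> G i \<in> borel_measurable (lebesgue_measure d)"
    and g_bdd: "\<And>x. x \<in> {..<d} \<rightarrow>\<^sub>E UNIV \<Longrightarrow> \<bar>g x\<bar> \<le> C"
    and G_bdd: "\<And>x. x \<in> {..<d} \<rightarrow>\<^sub>E UNIV \<Longrightarrow> (\<Sum>i<d. (G i x)\<^sup>2) \<le> \<Gamma>"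
    and semi: "\<And>x z. x \<in> {..<d} \<rightarrow>\<^sub>E UNIV \<Longrightarrow> z \<in> {..<d} \<rightarrow>\<^sub>E UNIV \<Longrightarrow>
      g x \<le> g z + (\<Sum>i<d. G i z * (x i - z i)) + K * (\<Sum>i<d. (x i - z i)\<^sup>2)"
  defines "Z \<equiv> LINT x|lebesgue_measure d. exp (- W x)"
    and "a \<equiv> LINT x|lebesgue_measure d. exp (g x) * exp (- W x)"
  shows "(LINT x|lebesgue_measure d. exp (g x) * g x * exp (- W x)) - a * ln (a / Z)
    \<le> 1 / (2 * \<kappa>) * (LINT x|lebesgue_measure d. (\<Sum>i<d. (G i x)\<^sup>2) * exp (g x) * exp (- W x))"
proof -
  let ?L = "lebesgue_measure d"
  define N where "N x = (\<Sum>i<d. (G i x)\<^sup>2)" for x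
  define b where "b = (LINT x|?L. exp (g x) * g x * exp (- W x))"
  define D where "D = (LINT x|?L. N x * exp (g x) * exp (- W x))"
  have [measurable]: "N \<in> borel_measurable ?L" unfolding N_def by measurable
  have N: "0 \<le> N x" for x by (simp add: N_def sum_nonneg)
  have N_bdd: "N x \<le> \<Gamma>" if "x \<in> space ?L" for x
    using G_bdd that by (simp add: N_def space_lebesgue_measure_PiE)
  have g_abs: "\<bar>g x\<bar> \<le> C" if "x \<in> space ?L" for x
    using g_bdd that by (simp add: space_lebesgue_measure_PiE)
  have exp_g: "exp (r * g x) \<le> exp (r * C)" if "x \<in> space ?L" "0 \<le> r" for x r
    using g_abs[OF that(1)] that(2) by (auto intro!: mult_left_mono)
  have int_a: "integrable ?L (\<lambda>x. exp (g x) * exp (- W x))"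
    by (rule integrable_bounded_mult[OF int, where C = "exp C"])
       (use exp_g[where r = 1] in auto)
  have int_b: "integrable ?L (\<lambda>x. g x * (exp (g x) * exp (- W x)))"
    by (rule integrable_bounded_mult[OF int_a]) (use g_abs in auto)
  have int_D: "integrable ?L (\<lambda>x. N x * (exp (g x) * exp (- W x)))"
    by (rule integrable_bounded_mult[OF int_a, where C = \<Gamma>]) (use N N_bdd in auto)
  have a: "0 < a" unfolding a_def by (rule integral_pos_lebesgue_measure[OF int_a]) simp
  have Z: "0 < Z" unfolding Z_def by (rule integral_pos_lebesgue_measure[OF int]) simp
  have b_eq: "b = (LINT x|?L. g x * (exp (g x) * exp (- W x)))"
    and D_eq: "D = (LINT x|?L. N x * (exp (g x) * exp (- W x)))"
    by (simp_all add: b_def D_def mult_ac)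
  have D_nn: "0 \<le> D" unfolding D_eq using N by (intro Bochner_Integration.integral_nonneg) simp
  have step: "b / a + ln Z \<le> ln a + (real m + 1) / (2 * (\<kappa> * real m - 2 * K))
      * exp (\<Gamma> / (2 * (\<kappa> * real m - 2 * K))) * (D / a)"
    if m: "0 < m" "2 * K < \<kappa> * real m" for m
  proof -
    define \<theta> where "\<theta> = 1 / (2 * (\<kappa> * real m - 2 * K))"
    have \<theta>: "0 < \<theta>" using m by (auto simp: \<theta>_def)
    define U where "U = (LINT x|?L. exp (1 / real m * g x) * (exp (g x) * exp (- W x)))"
    define V where "V = (LINT x|?L. exp (\<theta> * N x) * (exp (g x) * exp (- W x)))"
    have int_U: "integrable ?L (\<lambda>x. exp (1 / real m * g x) * (exp (g x) * exp (- W x)))"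
      by (rule integrable_bounded_mult[OF int_a, where C = "exp (1 / real m * C)"])
         (use exp_g[where r = "1 / real m"] in auto)
    have int_V: "integrable ?L (\<lambda>x. exp (\<theta> * N x) * (exp (g x) * exp (- W x)))"
      by (rule integrable_bounded_mult[OF int_a, where C = "exp (\<theta> * \<Gamma>)"])
         (use N_bdd \<theta> in auto)
    have "(\<integral>\<^sup>+x. ennreal (exp ((1 + 1 / real m) * g x - W x)) \<partial>?L)
        = (\<integral>\<^sup>+x. ennreal (exp (1 / real m * g x) * (exp (g x) * exp (- W x))) \<partial>?L)"
      by (simp add: exp_add[symmetric] exp_diff algebra_simps exp_minus field_simps)
    also have "\<dots> = ennreal U"
      unfolding U_def by (rule nn_integral_eq_integral[OF int_U]) simp
    finally have eU: "(\<integral>\<^sup>+x. ennreal (exp ((1 + 1 / real m) * g x - W x)) \<partial>?L) = ennreal U" .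
    have "(\<integral>\<^sup>+x. ennreal (exp (g x + (\<Sum>i<d. (G i x)\<^sup>2) / (2 * (\<kappa> * real m - 2 * K)) - W x)) \<partial>?L)
        = (\<integral>\<^sup>+x. ennreal (exp (\<theta> * N x) * (exp (g x) * exp (- W x))) \<partial>?L)"
      by (simp add: exp_add[symmetric] N_def \<theta>_def algebra_simps)
    also have "\<dots> = ennreal V"
      unfolding V_def by (rule nn_integral_eq_integral[OF int_V]) simp
    finally have eV: "(\<integral>\<^sup>+x. ennreal (exp (g x + (\<Sum>i<d. (G i x)\<^sup>2) / (2 * (\<kappa> * real m - 2 * K)) - W x)) \<partial>?L)
      = ennreal V" .
    have eZ: "(\<integral>\<^sup>+x. ennreal (exp (- W x)) \<partial>?L) = ennreal Z"
      unfolding Z_def by (rule nn_integral_eq_integral[OF int]) simp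
    \<comment> \<open>Jensen's inequality for \<open>exp\<close> and the mean \<open>c\<close> of \<open>g / m\<close>, by the tangent line at \<open>c\<close>\<close>
    have U_ge: "exp (b / (a * real m)) * a \<le> U"
    proof -
      define c where "c = b / (a * real m)"
      have "exp c * a = exp c * (a + b / real m - c * a)"
        using a m by (simp add: c_def)
      also have "\<dots> = (LINT x|?L. exp c * ((1 - c) * (exp (g x) * exp (- W x))
          + 1 / real m * (g x * (exp (g x) * exp (- W x)))))"
        using int_a int_b by (simp add: a_def b_eq algebra_simps)
      also have "\<dots> \<le> U"
        unfolding U_def
      proof (rule integral_mono[OF _ int_U])
        fix x
        have "exp c * (1 + (1 / real m * g x - c)) \<le> exp c * exp (1 / real m * g x - c)"
          by (intro mult_left_mono exp_ge_add_one_self) auto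
        also have "\<dots> = exp (1 / real m * g x)" by (simp add: exp_diff)
        finally have "exp c * (1 + (1 / real m * g x - c)) * (exp (g x) * exp (- W x))
          \<le> exp (1 / real m * g x) * (exp (g x) * exp (- W x))"
          by (rule mult_right_mono) simp
        then show "exp c * ((1 - c) * (exp (g x) * exp (- W x))
          + 1 / real m * (g x * (exp (g x) * exp (- W x)))) \<le> exp (1 / real m * g x) * (exp (g x) * exp (- W x))"
          by (simp add: algebra_simps)
      qed (use int_a int_b in simp)
      finally show ?thesis by (simp add: c_def)
    qed
    \<comment> \<open>\<open>exp y \<le> 1 + y exp y\<close> for \<open>y = \<theta> N x\<close>, where \<open>\<theta>\<close> is of order \<open>1 / m\<close>\<close>
    have V_le: "V \<le> a + \<theta> * exp (\<theta> * \<Gamma>) * D"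
    proof -
      have "V \<le> (LINT x|?L. exp (g x) * exp (- W x) + \<theta> * exp (\<theta> * \<Gamma>) * (N x * (exp (g x) * exp (- W x))))"
        unfolding V_def
      proof (rule integral_mono[OF int_V])
        fix x assume x: "x \<in> space ?L"
        have "exp (\<theta> * N x) * (1 + - (\<theta> * N x)) \<le> exp (\<theta> * N x) * exp (- (\<theta> * N x))"
          by (intro mult_left_mono exp_ge_add_one_self) auto
        then have "exp (\<theta> * N x) \<le> 1 + \<theta> * N x * exp (\<theta> * N x)"
          by (simp add: exp_minus_inverse algebra_simps)
        also have "\<dots> \<le> 1 + \<theta> * N x * exp (\<theta> * \<Gamma>)"
          using N_bdd[OF x] N \<theta> by (auto intro!: mult_left_mono)
        finally have "exp (\<theta> * N x) * (exp (g x) * exp (- W x))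
            \<le> (1 + \<theta> * N x * exp (\<theta> * \<Gamma>)) * (exp (g x) * exp (- W x))"
          by (rule mult_right_mono) simp
        then show "exp (\<theta> * N x) * (exp (g x) * exp (- W x))
          \<le> exp (g x) * exp (- W x) + \<theta> * exp (\<theta> * \<Gamma>) * (N x * (exp (g x) * exp (- W x)))"
          by (simp add: algebra_simps)
      qed (use int_a int_D in simp)
      also have "\<dots> = a + \<theta> * exp (\<theta> * \<Gamma>) * D"
        using int_a int_D by (simp add: a_def D_eq)
      finally show ?thesis .
    qed
    have U: "0 < U" using U_ge a by (smt (verit) exp_gt_zero mult_pos_pos)
    have V: "0 < V" unfolding V_def by (rule integral_pos_lebesgue_measure[OF int_V]) simp
    have "ennreal U ^ m * ennreal Z \<le> ennreal V ^ (m + 1)"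
      using prekopa_leindler_exponential[OF m sc W g G semi] unfolding eU eV eZ .
    then have "U ^ m * Z \<le> V ^ (m + 1)"
      using U V Z by (simp add: ennreal_power ennreal_mult[symmetric] ennreal_le_iff del: power_Suc)
    then have "ln (U ^ m * Z) \<le> ln (V ^ (m + 1))"
      using U V Z by (subst ln_le_cancel_iff) auto
    then have "real m * ln U + ln Z \<le> (real m + 1) * ln V"
      using U V Z by (simp add: ln_mult ln_realpow algebra_simps)
    moreover have "real m * (b / (a * real m) + ln a) \<le> real m * ln U"
    proof (intro mult_left_mono)
      have "ln (exp (b / (a * real m)) * a) \<le> ln U"
        using U_ge U a by (subst ln_le_cancel_iff) auto
      then show "b / (a * real m) + ln a \<le> ln U" using a by (simp add: ln_mult)
    qed simp
    moreover have "(real m + 1) * ln V \<le> (real m + 1) * (ln a + \<theta> * exp (\<theta> * \<Gamma>) * D / a)"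
    proof (intro mult_left_mono)
      have "ln (V / a) \<le> V / a - 1" using V a by (intro ln_le_minus_one) auto
      moreover have "V / a \<le> (a + \<theta> * exp (\<theta> * \<Gamma>) * D) / a"
        using V_le a by (intro divide_right_mono) auto
      ultimately show "ln V \<le> ln a + \<theta> * exp (\<theta> * \<Gamma>) * D / a"
        using V a by (simp add: ln_div add_divide_distrib)
    qed simp
    ultimately have "b / a + ln Z \<le> ln a + (real m + 1) * (\<theta> * exp (\<theta> * \<Gamma>) * D / a)"
      using m a by (simp add: algebra_simps)
    then show ?thesis by (simp add: \<theta>_def)
  qed
  have lim0: "(\<lambda>m. 1 / (2 * (\<kappa> * real m - 2 * K))) \<longlonglongrightarrow> 0"
    using \<kappa> by real_asymp
  have lim1: "(\<lambda>m. (real m + 1) / (2 * (\<kappa> * real m - 2 * K))) \<longlonglongrightarrow> 1 / (2 * \<kappa>)"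
  proof -
    have "(\<lambda>m. (real m + 1) / (2 * (\<kappa> * real m - 2 * K))) \<longlonglongrightarrow> inverse \<kappa> / 2"
      using \<kappa> by real_asymp
    then show ?thesis by (simp add: field_simps)
  qed
  have "(\<lambda>m. ln a + (real m + 1) / (2 * (\<kappa> * real m - 2 * K))
      * exp (\<Gamma> * (1 / (2 * (\<kappa> * real m - 2 * K)))) * (D / a)) \<longlonglongrightarrow> ln a + 1 / (2 * \<kappa>) * exp (\<Gamma> * 0) * (D / a)"
    by (intro tendsto_intros lim0 lim1)
  moreover have "\<forall>\<^sub>F m in sequentially. b / a + ln Z \<le> ln a + (real m + 1) / (2 * (\<kappa> * real m - 2 * K))
      * exp (\<Gamma> * (1 / (2 * (\<kappa> * real m - 2 * K)))) * (D / a)"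
  proof -
    have "\<forall>\<^sub>F m in sequentially. 2 * K < \<kappa> * real m" using \<kappa> by real_asymp
    with eventually_gt_at_top[of "0::nat"] show ?thesis
      by eventually_elim (use step in simp)
  qed
  ultimately have "b / a + ln Z \<le> ln a + 1 / (2 * \<kappa>) * exp (\<Gamma> * 0) * (D / a)"
    by (rule tendsto_lowerbound) simp
  then have "a * (b / a + ln Z) \<le> a * (ln a + 1 / (2 * \<kappa>) * (D / a))"
    using a by (intro mult_left_mono) auto
  then have "b - a * ln (a / Z) \<le> 1 / (2 * \<kappa>) * D"
    using a Z by (simp add: ln_div algebra_simps)
  then show ?thesis unfolding b_def D_def N_def .
qed

section \<open>Calculus with partial derivatives on \<open>euclid d\<close>\<close>

lemma sum_abs_power2_le:
  "(\<Sum>i<d. \<bar>h i\<bar>)\<^sup>2 \<le> real d * (\<Sum>i<d. (h i :: real)\<^sup>2)"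
  using sum_squared_le_sum_of_squares[of "\<lambda>i. \<bar>h i\<bar>" "{..<d}"] by (simp add: mult.commute)

lemma topspace_euclid: "topspace (euclid d) = {..<d} \<rightarrow>\<^sub>E UNIV"
  by (simp add: euclid_def)

lemma continuous_map_euclid_fun_upd:
  assumes "x \<in> topspace (euclid d)" "i < d"
  shows "continuous_map euclideanreal (euclid d) (\<lambda>t. x(i := t))"
  unfolding euclid_def continuous_map_componentwise
proof (intro conjI ballI)
  show "(\<lambda>t. x(i := t)) ` topspace euclideanreal \<subseteq> extensional {..<d}"
    using assms by (auto simp: topspace_euclid PiE_iff extensional_def)
  fix k assume "k \<in> {..<d}"
  show "continuous_map euclideanreal euclideanreal (\<lambda>t. (x(i := t)) k)"
    by (cases "k = i") auto
qed

text \<open>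
  For the full index set the Borel sets of the product topology are the product sigma-algebra;
  composing with the restriction to \<open>{..<d}\<close> and with the extension by zero transfers this to
  \<open>d\<close> coordinates.
\<close>

lemma borel_measurable_continuous_map_euclid:
  assumes "continuous_map (euclid d) euclideanreal h"
  shows "h \<in> borel_measurable (lebesgue_measure d)"
proof -
  define h' where "h' = h \<circ> (\<lambda>y. restrict y {..<d})"
  define e where "e x = (\<lambda>i. if i < d then x i else (0::real))" for x :: "nat \<Rightarrow> real"
  have "continuous_map (product_topology (\<lambda>_. euclideanreal) UNIV) (euclid d) (\<lambda>y. restrict y {..<d})"
    unfolding euclid_def continuous_map_componentwise
    by (auto intro!: continuous_map_product_projection[of _ UNIV "\<lambda>_. euclideanreal", simplified])
  then have "continuous_map (product_topology (\<lambda>_. euclideanreal) UNIV) euclideanreal h'"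
    unfolding h'_def using assms by (rule continuous_map_compose)
  then have "continuous_on UNIV h'"
    by (simp add: euclidean_product_topology)
  then have h': "h' \<in> borel_measurable borel"
    by (rule borel_measurable_continuous_onI)
  have "e \<in> measurable (lebesgue_measure d) (Pi\<^sub>M UNIV (\<lambda>_. borel))"
  proof (rule measurable_PiM_single')
    fix i :: nat
    show "(\<lambda>x. e x i) \<in> measurable (lebesgue_measure d) borel"
      unfolding e_def lebesgue_measure_def by (cases "i < d") auto
  qed auto
  moreover have "sets (Pi\<^sub>M (UNIV::nat set) (\<lambda>_. borel :: real measure)) = sets borel"
    by (rule sets_PiM_equal_borel)
  ultimately have "e \<in> measurable (lebesgue_measure d) borel"
    using measurable_cong_sets by blast
  then have "(\<lambda>x. h' (e x)) \<in> borel_measurable (lebesgue_measure d)"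
    using h' by (rule measurable_compose)
  moreover have "h' (e x) = h x" if "x \<in> space (lebesgue_measure d)" for x
  proof -
    have "restrict (e x) {..<d} = x"
      using that by (auto simp: space_lebesgue_measure topspace_euclid e_def fun_eq_iff PiE_iff extensional_def)
    then show ?thesis by (simp add: h'_def)
  qed
  ultimately show ?thesis by (simp cong: measurable_cong)
qed

text \<open>
  Walk from \<open>x\<close> to \<open>y\<close> by changing one coordinate at a time and use the one-variable mean value
  theorem on each leg. This yields all estimates needed here directly from partial derivatives,
  without the Frechet derivative or the chain rule, at the price of constants that depend on the
  dimension.
\<close>

lemma coordinatewise_mean_value:
  assumes diff: "\<And>i z. i < d \<Longrightarrow> z \<in> topspace (euclid d) \<Longrightarrow> has_partial_deriv i f z"
    and xy: "x \<in> topspace (euclid d)" "y \<in> topspace (euclid d)"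
  shows "\<exists>\<xi>. (\<forall>k<d. \<xi> k \<in> topspace (euclid d) \<and> (\<forall>i<d. \<bar>\<xi> k i - x i\<bar> \<le> \<bar>y i - x i\<bar>)) \<and>
    f y - f x = (\<Sum>k<d. partial_deriv k f (\<xi> k) * (y k - x k))"
proof -
  define z where "z k = (\<lambda>i\<in>{..<d}. if i < k then y i else x i)" for k
  have zS: "z k \<in> topspace (euclid d)" for k by (simp add: z_def topspace_euclid)
  have z0: "z 0 = x" and zd: "z d = y"
    using xy by (auto simp: z_def topspace_euclid fun_eq_iff PiE_iff extensional_def)
  have "\<exists>\<xi>. \<xi> \<in> topspace (euclid d) \<and> (\<forall>i<d. \<bar>\<xi> i - x i\<bar> \<le> \<bar>y i - x i\<bar>) \<and>
      f (z (Suc k)) - f (z k) = partial_deriv k f \<xi> * (y k - x k)" if k: "k < d" for k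
  proof -
    have updS: "(z k)(k := t) \<in> topspace (euclid d)" for t
      using zS[of k] k by (auto simp: topspace_euclid PiE_iff extensional_def)
    have der: "((\<lambda>t. f ((z k)(k := t))) has_real_derivative partial_deriv k f ((z k)(k := t))) (at t)" for t
      using diff[OF k updS[of t]] DERIV_deriv_iff_field_differentiable
      unfolding has_partial_deriv_def partial_deriv_def by fastforce
    have "\<exists>c. \<bar>c - x k\<bar> \<le> \<bar>y k - x k\<bar> \<and>
        f ((z k)(k := y k)) - f ((z k)(k := x k)) = partial_deriv k f ((z k)(k := c)) * (y k - x k)"
    proof -
      consider "x k < y k" | "y k < x k" | "x k = y k" by linarith
      then show ?thesis
      proof cases
        case 1
        from MVT2[OF this der] obtain c where "x k < c" "c < y k"
          "f ((z k)(k := y k)) - f ((z k)(k := x k)) = (y k - x k) * partial_deriv k f ((z k)(k := c))" by auto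
        then show ?thesis by (intro exI[of _ c]) auto
      next
        case 2
        from MVT2[OF this der] obtain c where "y k < c" "c < x k"
          "f ((z k)(k := x k)) - f ((z k)(k := y k)) = (x k - y k) * partial_deriv k f ((z k)(k := c))" by auto
        then show ?thesis by (intro exI[of _ c]) (auto simp: algebra_simps)
      qed (auto intro!: exI[of _ "x k"])
    qed
    then obtain c where c: "\<bar>c - x k\<bar> \<le> \<bar>y k - x k\<bar>"
      "f ((z k)(k := y k)) - f ((z k)(k := x k)) = partial_deriv k f ((z k)(k := c)) * (y k - x k)" by blast
    have "(z k)(k := y k) = z (Suc k)" "(z k)(k := x k) = z k"
      using k by (auto simp: z_def fun_eq_iff restrict_def)
    then show ?thesis
      using c updS[of c] by (intro exI[of _ "(z k)(k := c)"]) (auto simp: z_def)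
  qed
  then obtain \<xi> where \<xi>: "\<And>k. k < d \<Longrightarrow> \<xi> k \<in> topspace (euclid d) \<and> (\<forall>i<d. \<bar>\<xi> k i - x i\<bar> \<le> \<bar>y i - x i\<bar>) \<and>
      f (z (Suc k)) - f (z k) = partial_deriv k f (\<xi> k) * (y k - x k)"
    by metis
  have "f y - f x = (\<Sum>k<d. f (z (Suc k)) - f (z k))"
    by (simp add: sum_lessThan_telescope[of "\<lambda>k. f (z k)"] z0 zd)
  also have "\<dots> = (\<Sum>k<d. partial_deriv k f (\<xi> k) * (y k - x k))"
    using \<xi> by (intro sum.cong) auto
  finally show ?thesis using \<xi> by blast
qed

lemma partial_deriv_bounded_lipschitz:
  assumes diff: "\<And>i z. i < d \<Longrightarrow> z \<in> topspace (euclid d) \<Longrightarrow> has_partial_deriv i f z"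
    and bd: "\<And>i z. i < d \<Longrightarrow> z \<in> topspace (euclid d) \<Longrightarrow> \<bar>partial_deriv i f z\<bar> \<le> M"
    and xy: "x \<in> topspace (euclid d)" "y \<in> topspace (euclid d)"
  shows "\<bar>f y - f x\<bar> \<le> M * (\<Sum>i<d. \<bar>y i - x i\<bar>)"
proof -
  obtain \<xi> where \<xi>: "\<And>k. k < d \<Longrightarrow> \<xi> k \<in> topspace (euclid d)"
    "f y - f x = (\<Sum>k<d. partial_deriv k f (\<xi> k) * (y k - x k))"
    using coordinatewise_mean_value[OF diff xy] by blast
  have "\<bar>f y - f x\<bar> \<le> (\<Sum>k<d. \<bar>partial_deriv k f (\<xi> k) * (y k - x k)\<bar>)"
    unfolding \<xi>(2) by (rule sum_abs)
  also have "\<dots> \<le> (\<Sum>k<d. M * \<bar>y k - x k\<bar>)"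
    using bd \<xi>(1) by (intro sum_mono) (auto simp: abs_mult intro!: mult_right_mono)
  finally show ?thesis by (simp add: sum_distrib_left)
qed

lemma partial_deriv2_bounded_taylor:
  assumes diff: "\<And>i z. i < d \<Longrightarrow> z \<in> topspace (euclid d) \<Longrightarrow> has_partial_deriv i f z"
    and diff2: "\<And>i j z. i < d \<Longrightarrow> j < d \<Longrightarrow> z \<in> topspace (euclid d) \<Longrightarrow> has_partial_deriv i (partial_deriv j f) z"
    and bd2: "\<And>i j z. i < d \<Longrightarrow> j < d \<Longrightarrow> z \<in> topspace (euclid d) \<Longrightarrow> \<bar>partial_deriv i (partial_deriv j f) z\<bar> \<le> M"
    and xy: "x \<in> topspace (euclid d)" "y \<in> topspace (euclid d)"
  shows "\<bar>f y - f x - (\<Sum>i<d. partial_deriv i f x * (y i - x i))\<bar> \<le> M * (\<Sum>i<d. \<bar>y i - x i\<bar>)\<^sup>2"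
proof -
  define S where "S = (\<Sum>i<d. \<bar>y i - x i\<bar>)"
  obtain \<xi> where \<xi>: "\<And>k. k < d \<Longrightarrow> \<xi> k \<in> topspace (euclid d)"
    "\<And>k i. k < d \<Longrightarrow> i < d \<Longrightarrow> \<bar>\<xi> k i - x i\<bar> \<le> \<bar>y i - x i\<bar>"
    "f y - f x = (\<Sum>k<d. partial_deriv k f (\<xi> k) * (y k - x k))"
    using coordinatewise_mean_value[OF diff xy] by blast
  have lip: "\<bar>partial_deriv k f (\<xi> k) - partial_deriv k f x\<bar> \<le> M * S" if k: "k < d" for k
  proof -
    have "0 \<le> M" using bd2[OF k k xy(1)] by linarith
    have "\<bar>partial_deriv k f (\<xi> k) - partial_deriv k f x\<bar> \<le> M * (\<Sum>i<d. \<bar>\<xi> k i - x i\<bar>)"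
      using diff2 bd2 xy \<xi>(1) k by (intro partial_deriv_bounded_lipschitz) auto
    also have "\<dots> \<le> M * S"
      unfolding S_def using \<open>0 \<le> M\<close> \<xi>(2) k by (intro mult_left_mono sum_mono) auto
    finally show ?thesis .
  qed
  have "\<bar>f y - f x - (\<Sum>i<d. partial_deriv i f x * (y i - x i))\<bar>
      = \<bar>\<Sum>k<d. (partial_deriv k f (\<xi> k) - partial_deriv k f x) * (y k - x k)\<bar>"
    unfolding \<xi>(3) by (simp add: sum_subtractf left_diff_distrib)
  also have "\<dots> \<le> (\<Sum>k<d. \<bar>(partial_deriv k f (\<xi> k) - partial_deriv k f x) * (y k - x k)\<bar>)"
    by (rule sum_abs)
  also have "\<dots> \<le> (\<Sum>k<d. M * S * \<bar>y k - x k\<bar>)"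
    using lip by (intro sum_mono) (auto simp: abs_mult intro!: mult_right_mono)
  also have "\<dots> = M * S\<^sup>2"
    by (simp add: S_def sum_distrib_left[symmetric] power2_eq_square)
  finally show ?thesis by (simp add: S_def)
qed

text \<open>
  All iterated partial derivatives vanish off the support \<open>K\<close> of \<open>f\<close>, because the complement of
  \<open>K\<close> is open also along coordinate lines, and on the compact set \<open>K\<close> they are bounded by
  continuity.
\<close>

lemma Cc_infty_iterated_partial_deriv_bounded:
  assumes f: "f \<in> Cc_infty d" and js: "js \<in> lists {..<d}"
  shows "\<exists>M. \<forall>x\<in>topspace (euclid d). \<bar>foldr partial_deriv js f x\<bar> \<le> M"
proof -
  define K where "K = euclid d closure_of {x \<in> topspace (euclid d). f x \<noteq> 0}"
  have K: "compactin (euclid d) K" using f by (simp add: Cc_infty_def compact_support_def K_def)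
  have "{x \<in> topspace (euclid d). f x \<noteq> 0} \<subseteq> K"
    unfolding K_def by (rule closure_of_subset) auto
  have open_compl: "openin (euclid d) (topspace (euclid d) - K)"
    unfolding K_def by (simp add: openin_diff)
  have vanish: "foldr partial_deriv ks f x = 0"
    if "ks \<in> lists {..<d}" "x \<in> topspace (euclid d) - K" for ks x
    using that
  proof (induction ks arbitrary: x)
    case Nil
    then show ?case using \<open>_ \<subseteq> K\<close> by auto
  next
    case (Cons i ks)
    then have i: "i < d" and ks: "ks \<in> lists {..<d}" and x: "x \<in> topspace (euclid d)" by auto
    let ?g = "foldr partial_deriv ks f"
    have "openin euclideanreal {t \<in> topspace euclideanreal. x(i := t) \<in> topspace (euclid d) - K}"
      by (rule openin_continuous_map_preimage[OF continuous_map_euclid_fun_upd[OF x i] open_compl])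
    then have "open {t. x(i := t) \<in> topspace (euclid d) - K}" by simp
    then have "\<forall>\<^sub>F t in nhds (x i). x(i := t) \<in> topspace (euclid d) - K"
      using Cons.prems by (auto simp: eventually_nhds)
    then have "\<forall>\<^sub>F t in nhds (x i). ?g (x(i := t)) = 0"
      by (rule eventually_mono) (use Cons.IH ks in blast)
    then have "deriv (\<lambda>t. ?g (x(i := t))) (x i) = deriv (\<lambda>_. 0) (x i)"
      by (rule deriv_cong_ev) simp
    then show ?case by (simp add: partial_deriv_def[of i])
  qed
  have "continuous_map (euclid d) euclideanreal (foldr partial_deriv js f)"
    using f js by (simp add: Cc_infty_def smooth_def)
  then have "compact (foldr partial_deriv js f ` K)"
    using image_compactin[OF K] compactin_euclidean_iff by blast
  then obtain M where M: "\<And>x. x \<in> K \<Longrightarrow> \<bar>foldr partial_deriv js f x\<bar> \<le> M"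
    using compact_imp_bounded bounded_iff by (metis image_eqI real_norm_def)
  show ?thesis
  proof (intro exI ballI)
    fix x assume "x \<in> topspace (euclid d)"
    then show "\<bar>foldr partial_deriv js f x\<bar> \<le> \<bar>M\<bar>"
      using M[of x] vanish[OF js, of x] by (cases "x \<in> K") auto
  qed
qed

lemma Cc_infty_uniform_bounds:
  assumes f: "f \<in> Cc_infty d"
  obtains M where "0 \<le> M"
    "\<And>x. x \<in> topspace (euclid d) \<Longrightarrow> \<bar>f x\<bar> \<le> M"
    "\<And>i x. i < d \<Longrightarrow> x \<in> topspace (euclid d) \<Longrightarrow> \<bar>partial_deriv i f x\<bar> \<le> M"
    "\<And>i j x. i < d \<Longrightarrow> j < d \<Longrightarrow> x \<in> topspace (euclid d) \<Longrightarrow> \<bar>partial_deriv i (partial_deriv j f) x\<bar> \<le> M"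
proof -
  let ?J = "{[]} \<union> (\<lambda>i. [i]) ` {..<d} \<union> (\<lambda>(i, j). [i, j]) ` ({..<d} \<times> {..<d})"
  have "\<forall>js\<in>?J. \<exists>M. \<forall>x\<in>topspace (euclid d). \<bar>foldr partial_deriv js f x\<bar> \<le> M"
    by (intro ballI Cc_infty_iterated_partial_deriv_bounded[OF f]) auto
  then obtain B where B: "\<And>js x. js \<in> ?J \<Longrightarrow> x \<in> topspace (euclid d) \<Longrightarrow> \<bar>foldr partial_deriv js f x\<bar> \<le> B js"
    by metis
  define M where "M = (\<Sum>js\<in>?J. \<bar>B js\<bar>)"
  have M: "\<bar>foldr partial_deriv js f x\<bar> \<le> M" if "js \<in> ?J" "x \<in> topspace (euclid d)" for js x
  proof -
    have "\<bar>B js\<bar> \<le> M" unfolding M_def by (rule member_le_sum) (use that in auto)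
    then show ?thesis using B[OF that] by linarith
  qed
  show ?thesis
  proof (rule that[of M])
    show "0 \<le> M" by (simp add: M_def sum_nonneg)
    show "\<bar>f x\<bar> \<le> M" if "x \<in> topspace (euclid d)" for x
      using M[of "[]"] that by simp
    show "\<bar>partial_deriv i f x\<bar> \<le> M" if "i < d" "x \<in> topspace (euclid d)" for i x
      using M[of "[i]"] that by simp
    show "\<bar>partial_deriv i (partial_deriv j f) x\<bar> \<le> M"
      if "i < d" "j < d" "x \<in> topspace (euclid d)" for i j x
      using M[of "[i, j]"] that by force
  qed
qed

lemma Cc_infty_measurable:
  assumes "f \<in> Cc_infty d"
  shows "f \<in> borel_measurable (lebesgue_measure d)"
proof (rule borel_measurable_continuous_map_euclid)
  have "continuous_map (euclid d) euclideanreal (foldr partial_deriv [] f)"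
    using assms unfolding Cc_infty_def smooth_def by blast
  then show "continuous_map (euclid d) euclideanreal f" by simp
qed

lemma Cc_infty_partial_deriv:
  assumes f: "f \<in> Cc_infty d" and i: "i < d"
  shows "partial_deriv i f \<in> borel_measurable (lebesgue_measure d)"
    and "z \<in> topspace (euclid d) \<Longrightarrow> has_partial_deriv i f z"
    and "j < d \<Longrightarrow> z \<in> topspace (euclid d) \<Longrightarrow> has_partial_deriv j (partial_deriv i f) z"
proof -
  have s: "continuous_map (euclid d) euclideanreal (foldr partial_deriv js f)"
    "\<And>j z. j < d \<Longrightarrow> z \<in> topspace (euclid d) \<Longrightarrow> has_partial_deriv j (foldr partial_deriv js f) z"
    if "js \<in> lists {..<d}" for js
    using f that by (auto simp: Cc_infty_def smooth_def)
  show "partial_deriv i f \<in> borel_measurable (lebesgue_measure d)"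
    using s(1)[of "[i]"] i by (simp add: borel_measurable_continuous_map_euclid)
  show "has_partial_deriv i f z" if "z \<in> topspace (euclid d)"
    using s(2)[of "[]"] i that by simp
  show "has_partial_deriv j (partial_deriv i f) z" if "j < d" "z \<in> topspace (euclid d)"
    using s(2)[of "[i]"] i that by simp
qed

section \<open>The inequality for strongly log-concave weights\<close>

lemma integrable_sum_partial_deriv_square:
  assumes f: "f \<in> Cc_infty d" and s: "integrable (lebesgue_measure d) s"
  shows "integrable (lebesgue_measure d) (\<lambda>x. (\<Sum>i<d. (partial_deriv i f x)\<^sup>2) * s x)"
proof -
  obtain M where M: "\<And>i x. i < d \<Longrightarrow> x \<in> topspace (euclid d) \<Longrightarrow> \<bar>partial_deriv i f x\<bar> \<le> M"
    by (rule Cc_infty_uniform_bounds[OF f]) (rule that)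
  have [measurable]: "partial_deriv i f \<in> borel_measurable (lebesgue_measure d)" if "i < d" for i
    by (rule Cc_infty_partial_deriv[OF f that])
  show ?thesis
  proof (rule integrable_bounded_mult[OF s])
    show "(\<lambda>x. \<Sum>i<d. (partial_deriv i f x)\<^sup>2) \<in> borel_measurable (lebesgue_measure d)" by measurable
    fix x assume "x \<in> space (lebesgue_measure d)"
    then have x: "x \<in> topspace (euclid d)" by (simp add: space_lebesgue_measure)
    have "(\<Sum>i<d. (partial_deriv i f x)\<^sup>2) \<le> (\<Sum>i<d. M\<^sup>2)"
    proof (rule sum_mono)
      fix i assume "i \<in> {..<d}"
      then show "(partial_deriv i f x)\<^sup>2 \<le> M\<^sup>2"
        using power_mono[OF M[OF _ x], of i 2] by simp
    qed
    then show "\<bar>\<Sum>i<d. (partial_deriv i f x)\<^sup>2\<bar> \<le> (\<Sum>i<d. M\<^sup>2)"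
      by (simp add: sum_nonneg)
  qed
qed

text \<open>
  The choice \<open>g = ln F\<close> with \<open>F = f\<^sup>2 + \<epsilon>\<close> gives \<open>G = 2 f \<nabla>f / F\<close> and hence
  \<open>|G|\<^sup>2 F \<le> 4 |\<nabla>f|\<^sup>2\<close>. Adding \<open>\<epsilon>\<close> keeps the logarithm bounded. As \<open>ln\<close> is concave, the
  quadratic upper bound for \<open>g\<close> follows from that for \<open>F\<close>, and second derivatives of \<open>ln F\<close> do
  not enter.
\<close>

lemma log_sobolev_strongly_convex_Cc:
  assumes \<kappa>: "0 < \<kappa>" and \<epsilon>: "0 < \<epsilon>"
    and f: "f \<in> Cc_infty d"
    and sc: "strongly_convex d \<kappa> W"
    and W[measurable]: "W \<in> borel_measurable (lebesgue_measure d)"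
    and int: "integrable (lebesgue_measure d) (\<lambda>x. exp (- W x))"
  defines "F \<equiv> \<lambda>x. (f x)\<^sup>2 + \<epsilon>"
    and "Z \<equiv> LINT x|lebesgue_measure d. exp (- W x)"
  defines "a \<equiv> LINT x|lebesgue_measure d. F x * exp (- W x)"
  shows "(LINT x|lebesgue_measure d. F x * ln (F x) * exp (- W x)) - a * ln (a / Z)
    \<le> 2 / \<kappa> * (LINT x|lebesgue_measure d. (\<Sum>i<d. (partial_deriv i f x)\<^sup>2) * exp (- W x))"
proof -
  let ?L = "lebesgue_measure d"
  obtain M where M: "0 \<le> M"
    "\<And>x. x \<in> topspace (euclid d) \<Longrightarrow> \<bar>f x\<bar> \<le> M"
    "\<And>i x. i < d \<Longrightarrow> x \<in> topspace (euclid d) \<Longrightarrow> \<bar>partial_deriv i f x\<bar> \<le> M"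
    "\<And>i j x. i < d \<Longrightarrow> j < d \<Longrightarrow> x \<in> topspace (euclid d) \<Longrightarrow> \<bar>partial_deriv i (partial_deriv j f) x\<bar> \<le> M"
    using Cc_infty_uniform_bounds[OF f] by blast
  have [measurable]: "f \<in> borel_measurable ?L" by (rule Cc_infty_measurable[OF f])
  have [measurable]: "partial_deriv i f \<in> borel_measurable ?L" if "i < d" for i
    by (rule Cc_infty_partial_deriv[OF f that])
  have [measurable]: "F \<in> borel_measurable ?L" unfolding F_def by measurable
  have F: "\<epsilon> \<le> F x" "0 < F x" for x using \<epsilon> by (auto simp: F_def add_nonneg_pos)
  have F_le: "F x \<le> M\<^sup>2 + \<epsilon>" if "x \<in> topspace (euclid d)" for x
    using M(2)[OF that] by (simp add: F_def abs_le_square_iff[symmetric] abs_of_nonneg[OF M(1)])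
  define G where "G i x = 2 * f x * partial_deriv i f x / F x" for i x
  have [measurable]: "G i \<in> borel_measurable ?L" if "i < d" for i
    using that unfolding G_def by measurable
  have G_le: "\<bar>G i x\<bar> \<le> 2 * M * M / \<epsilon>" if "i < d" "x \<in> topspace (euclid d)" for i x
    unfolding G_def abs_divide abs_mult using M that F[of x] \<epsilon>
    by (intro frac_le mult_mono) auto
  have G_sum_le: "(\<Sum>i<d. (G i x)\<^sup>2) \<le> (\<Sum>i<d. (2 * M * M / \<epsilon>)\<^sup>2)"
    if x: "x \<in> topspace (euclid d)" for x
  proof (rule sum_mono)
    fix i assume "i \<in> {..<d}"
    then show "(G i x)\<^sup>2 \<le> (2 * M * M / \<epsilon>)\<^sup>2"
      using power_mono[OF G_le[OF _ x], of i 2] by simp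
  qed
  have sobolev: "(LINT x|?L. exp (ln (F x)) * ln (F x) * exp (- W x))
      - (LINT x|?L. exp (ln (F x)) * exp (- W x)) * ln ((LINT x|?L. exp (ln (F x)) * exp (- W x)) / Z)
    \<le> 1 / (2 * \<kappa>) * (LINT x|?L. (\<Sum>i<d. (G i x)\<^sup>2) * exp (ln (F x)) * exp (- W x))"
    unfolding Z_def
  proof (rule log_sobolev_strongly_convex[OF \<kappa> sc W int])
    fix x assume x: "x \<in> {..<d} \<rightarrow>\<^sub>E (UNIV :: real set)"
    then have x': "x \<in> topspace (euclid d)" by (simp add: topspace_euclid)
    have "ln \<epsilon> \<le> ln (F x)" "ln (F x) \<le> ln (M\<^sup>2 + \<epsilon>)"
      using F F_le[OF x'] \<epsilon> by (auto simp: ln_le_cancel_iff add_nonneg_pos)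
    then show "\<bar>ln (F x)\<bar> \<le> \<bar>ln \<epsilon>\<bar> + \<bar>ln (M\<^sup>2 + \<epsilon>)\<bar>" by linarith
    show "(\<Sum>i<d. (G i x)\<^sup>2) \<le> (\<Sum>i<d. (2 * M * M / \<epsilon>)\<^sup>2)" by (rule G_sum_le[OF x'])
  next
    fix x z assume xz: "x \<in> {..<d} \<rightarrow>\<^sub>E (UNIV :: real set)" "z \<in> {..<d} \<rightarrow>\<^sub>E (UNIV :: real set)"
    then have x: "x \<in> topspace (euclid d)" and z: "z \<in> topspace (euclid d)"
      by (simp_all add: topspace_euclid)
    define S where "S = (\<Sum>i<d. \<bar>x i - z i\<bar>)"
    define P where "P = (\<Sum>i<d. partial_deriv i f z * (x i - z i))"
    define \<Delta> where "\<Delta> = f x - f z"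
    have lip: "\<bar>\<Delta>\<bar> \<le> M * S"
      unfolding \<Delta>_def S_def
      by (rule partial_deriv_bounded_lipschitz[OF _ _ z x]) (use Cc_infty_partial_deriv[OF f] M in auto)
    have taylor: "\<bar>\<Delta> - P\<bar> \<le> M * S\<^sup>2"
      unfolding \<Delta>_def S_def P_def
      by (rule partial_deriv2_bounded_taylor[OF _ _ _ z x]) (use Cc_infty_partial_deriv[OF f] M in auto)
    have "f z * (\<Delta> - P) \<le> \<bar>f z\<bar> * \<bar>\<Delta> - P\<bar>" by (metis abs_ge_self abs_mult)
    also have "\<dots> \<le> M * (M * S\<^sup>2)" using M(2)[OF z] taylor by (intro mult_mono) auto
    finally have 1: "f z * \<Delta> \<le> f z * P + M\<^sup>2 * S\<^sup>2"
      by (simp add: algebra_simps power2_eq_square)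
    have "\<bar>\<Delta>\<bar>\<^sup>2 \<le> (M * S)\<^sup>2" using lip by (intro power_mono) auto
    then have 2: "\<Delta>\<^sup>2 \<le> M\<^sup>2 * S\<^sup>2" by (simp add: power_mult_distrib)
    have "F x - F z = 2 * (f z * \<Delta>) + \<Delta>\<^sup>2"
      by (simp add: F_def \<Delta>_def power2_eq_square algebra_simps)
    also have "\<dots> \<le> 2 * f z * P + 3 * M\<^sup>2 * S\<^sup>2" using 1 2 by simp
    finally have "(F x - F z) / F z \<le> (2 * f z * P + 3 * M\<^sup>2 * S\<^sup>2) / F z"
      using F[of z] by (intro divide_right_mono) auto
    also have "\<dots> = 2 * f z * P / F z + 3 * M\<^sup>2 * S\<^sup>2 / F z"
      by (rule add_divide_distrib)
    also have "2 * f z * P / F z = (\<Sum>i<d. G i z * (x i - z i))"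
      unfolding P_def G_def sum_distrib_left sum_divide_distrib times_divide_eq_left mult.assoc ..
    also have "3 * M\<^sup>2 * S\<^sup>2 / F z \<le> 3 * M\<^sup>2 * (real d * (\<Sum>i<d. (x i - z i)\<^sup>2)) / \<epsilon>"
      using F[of z] \<epsilon> unfolding S_def
      by (intro frac_le mult_left_mono sum_abs_power2_le) (auto intro!: mult_nonneg_nonneg sum_nonneg)
    finally have 3: "(F x - F z) / F z
      \<le> (\<Sum>i<d. G i z * (x i - z i)) + 3 * M\<^sup>2 * real d / \<epsilon> * (\<Sum>i<d. (x i - z i)\<^sup>2)"
      by (simp add: mult_ac)
    have "ln (F x / F z) \<le> F x / F z - 1"
      using F by (intro ln_le_minus_one) simp
    then have "ln (F x) \<le> ln (F z) + (F x - F z) / F z"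
      using F[of x] F[of z] by (simp add: ln_div diff_divide_distrib)
    with 3 show "ln (F x) \<le> ln (F z) + (\<Sum>i<d. G i z * (x i - z i))
        + 3 * M\<^sup>2 * real d / \<epsilon> * (\<Sum>i<d. (x i - z i)\<^sup>2)"
      by linarith
  qed measurable
  have "(LINT x|?L. (\<Sum>i<d. (G i x)\<^sup>2) * exp (ln (F x)) * exp (- W x))
      \<le> (LINT x|?L. 4 * ((\<Sum>i<d. (partial_deriv i f x)\<^sup>2) * exp (- W x)))"
  proof (rule integral_mono)
    fix x
    have "(\<Sum>i<d. (G i x)\<^sup>2) * F x = 4 * ((f x)\<^sup>2 / F x) * (\<Sum>i<d. (partial_deriv i f x)\<^sup>2)"
      using F(2)[of x] unfolding G_def
      by (simp add: sum_distrib_left sum_distrib_right power_divide power_mult_distrib)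
         (simp add: power2_eq_square field_simps)
    also have "\<dots> \<le> 4 * 1 * (\<Sum>i<d. (partial_deriv i f x)\<^sup>2)"
    proof (intro mult_right_mono mult_left_mono)
      show "(f x)\<^sup>2 / F x \<le> 1" using F(2)[of x] \<epsilon> by (simp add: F_def)
    qed (auto intro: sum_nonneg)
    finally have "(\<Sum>i<d. (G i x)\<^sup>2) * F x * exp (- W x) \<le> 4 * 1 * (\<Sum>i<d. (partial_deriv i f x)\<^sup>2) * exp (- W x)"
      by (rule mult_right_mono) simp
    then show "(\<Sum>i<d. (G i x)\<^sup>2) * exp (ln (F x)) * exp (- W x)
        \<le> 4 * ((\<Sum>i<d. (partial_deriv i f x)\<^sup>2) * exp (- W x))"
      using F(2)[of x] by (simp add: mult.assoc)
  next
    have "integrable ?L (\<lambda>x. ((\<Sum>i<d. (G i x)\<^sup>2) * F x) * exp (- W x))"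
    proof (rule integrable_bounded_mult[OF int])
      fix x assume "x \<in> space ?L"
      then have x: "x \<in> topspace (euclid d)" by (simp add: space_lebesgue_measure)
      from G_sum_le[OF x] have "(\<Sum>i<d. (G i x)\<^sup>2) * F x \<le> (\<Sum>i<d. (2 * M * M / \<epsilon>)\<^sup>2) * (M\<^sup>2 + \<epsilon>)"
        using F(2)[of x] F_le[OF x] by (intro mult_mono) (auto intro: sum_nonneg)
      moreover have "0 \<le> (\<Sum>i<d. (G i x)\<^sup>2) * F x"
        using F(2)[of x] by (intro mult_nonneg_nonneg sum_nonneg) auto
      ultimately show "\<bar>(\<Sum>i<d. (G i x)\<^sup>2) * F x\<bar> \<le> (\<Sum>i<d. (2 * M * M / \<epsilon>)\<^sup>2) * (M\<^sup>2 + \<epsilon>)"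
        by linarith
    qed measurable
    then show "integrable ?L (\<lambda>x. (\<Sum>i<d. (G i x)\<^sup>2) * exp (ln (F x)) * exp (- W x))"
      using F(2) by simp
    show "integrable ?L (\<lambda>x. 4 * ((\<Sum>i<d. (partial_deriv i f x)\<^sup>2) * exp (- W x)))"
      by (intro integrable_mult_right integrable_sum_partial_deriv_square f int)
  qed
  also have "\<dots> = 4 * (LINT x|?L. (\<Sum>i<d. (partial_deriv i f x)\<^sup>2) * exp (- W x))" by simp
  finally have "1 / (2 * \<kappa>) * (LINT x|?L. (\<Sum>i<d. (G i x)\<^sup>2) * exp (ln (F x)) * exp (- W x))
      \<le> 1 / (2 * \<kappa>) * (4 * (LINT x|?L. (\<Sum>i<d. (partial_deriv i f x)\<^sup>2) * exp (- W x)))"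
    using \<kappa> by (intro mult_left_mono) auto
  with sobolev show ?thesis
    using F(2) by (simp add: a_def)
qed

section \<open>A strongly convex potential close to the quartic one\<close>

text \<open>
  The quadratic part is an identity: \<open>|t x + (1 - t) y|\<^sup>2\<close> falls short of
  \<open>t |x|\<^sup>2 + (1 - t) |y|\<^sup>2\<close> by \<open>t (1 - t) |x - y|\<^sup>2\<close>. Monotonicity of \<open>p\<close> allows this shortfall
  to be dropped inside \<open>p\<close>, and then convexity applies.
\<close>

lemma strongly_convex_radial:
  fixes p :: "real \<Rightarrow> real"
  assumes p: "convex_on UNIV p" "mono p"
  shows "strongly_convex d \<kappa> (\<lambda>x. \<kappa> / 2 * (\<Sum>i<d. (x i)\<^sup>2) + p (\<Sum>i<d. (x i)\<^sup>2))"
  unfolding strongly_convex_def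
proof (intro ballI)
  fix x y :: "nat \<Rightarrow> real" and t :: real assume t: "t \<in> {0..1}"
  define X Y D where "X = (\<Sum>i<d. (x i)\<^sup>2)" and "Y = (\<Sum>i<d. (y i)\<^sup>2)" and "D = (\<Sum>i<d. (x i - y i)\<^sup>2)"
  have "(\<Sum>i<d. (t * x i + (1 - t) * y i)\<^sup>2)
      = (\<Sum>i<d. t * (x i)\<^sup>2 + (1 - t) * (y i)\<^sup>2 - t * (1 - t) * (x i - y i)\<^sup>2)"
    by (intro sum.cong) (auto simp: power2_eq_square algebra_simps)
  also have "\<dots> = t * X + (1 - t) * Y - t * (1 - t) * D"
    by (simp add: X_def Y_def D_def sum.distrib sum_subtractf sum_distrib_left)
  finally have z: "(\<Sum>i<d. ((\<lambda>i\<in>{..<d}. t * x i + (1 - t) * y i) i)\<^sup>2) = t * X + (1 - t) * Y - t * (1 - t) * D"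
    by simp
  have "0 \<le> t * (1 - t) * D" using t by (auto simp: D_def intro!: mult_nonneg_nonneg sum_nonneg)
  then have "p (t * X + (1 - t) * Y - t * (1 - t) * D) \<le> p (t * X + (1 - t) * Y)"
    by (intro monoD[OF p(2)]) simp
  also have "\<dots> \<le> t * p X + (1 - t) * p Y"
    using convex_onD[OF p(1), of "1 - t" X Y] t by simp
  finally have p_z: "p (t * X + (1 - t) * Y - t * (1 - t) * D) \<le> t * p X + (1 - t) * p Y" .
  have "k * (t * X + (1 - t) * Y - t * (1 - t) * D) + k * (t * (1 - t)) * D
    = t * (k * X) + (1 - t) * (k * Y)" for k
    by (simp add: algebra_simps)
  from p_z this[of "\<kappa> / 2"] show "\<kappa> / 2 * (\<Sum>i<d. ((\<lambda>i\<in>{..<d}. t * x i + (1 - t) * y i) i)\<^sup>2)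
      + p (\<Sum>i<d. ((\<lambda>i\<in>{..<d}. t * x i + (1 - t) * y i) i)\<^sup>2)
      + \<kappa> / 2 * (t * (1 - t)) * (\<Sum>i<d. (x i - y i)\<^sup>2)
    \<le> t * (\<kappa> / 2 * (\<Sum>i<d. (x i)\<^sup>2) + p (\<Sum>i<d. (x i)\<^sup>2))
      + (1 - t) * (\<kappa> / 2 * (\<Sum>i<d. (y i)\<^sup>2) + p (\<Sum>i<d. (y i)\<^sup>2))"
    unfolding z X_def[symmetric] Y_def[symmetric] D_def[symmetric] distrib_left
    by linarith
qed

lemma convex_on_square_positive_part:
  "convex_on UNIV (\<lambda>r::real. (max (r - a) 0)\<^sup>2 / 4)"
proof (rule convex_onI)
  fix t r s :: real assume t: "0 < t" "t < 1"
  define A B where "A = max (r - a) 0" and "B = max (s - a) 0"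
  have "(1 - t) * r + t * s - a = (1 - t) * (r - a) + t * (s - a)" by (simp add: algebra_simps)
  also have "\<dots> \<le> (1 - t) * A + t * B"
    using t by (intro add_mono mult_left_mono) (auto simp: A_def B_def)
  finally have "max ((1 - t) * r + t * s - a) 0 \<le> (1 - t) * A + t * B"
    using t by (auto simp: A_def B_def)
  then have "(max ((1 - t) * r + t * s - a) 0)\<^sup>2 \<le> ((1 - t) * A + t * B)\<^sup>2"
    by (intro power_mono) auto
  also have "\<dots> = (1 - t) * A\<^sup>2 + t * B\<^sup>2 - t * (1 - t) * (A - B)\<^sup>2"
    by (simp add: power2_eq_square algebra_simps)
  also have "\<dots> \<le> (1 - t) * A\<^sup>2 + t * B\<^sup>2" using t by simp
  finally show "(max ((1 - t) *\<^sub>R r + t *\<^sub>R s - a) 0)\<^sup>2 / 4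
    \<le> (1 - t) * ((max (r - a) 0)\<^sup>2 / 4) + t * ((max (s - a) 0)\<^sup>2 / 4)"
    by (simp add: A_def B_def)
qed simp

text \<open>
  With \<open>r = |x|\<^sup>2\<close>, \<open>\<phi>\<close> is the given potential. Its derivative in \<open>r\<close> is \<open>(r - \<beta>) / 2\<close>, which
  is less than \<open>1 / 2\<close> precisely for \<open>r < \<beta> + 1\<close>. Raising the derivative to \<open>1 / 2\<close> there
  gives \<open>w\<close>, and the total change is the area \<open>(\<beta> + 1)\<^sup>2 / 4\<close> of a triangle. The dimension
  does not enter, because everything is a function of \<open>|x|\<^sup>2\<close>.
\<close>

lemma quartic_within_bounded_distance_of_convex:
  fixes \<beta> r :: real
  assumes "0 < \<beta>" "0 \<le> r"
  defines "\<phi> \<equiv> r\<^sup>2 / 4 - \<beta> * r / 2" and "w \<equiv> 1 / 2 * r + (max (r - (\<beta> + 1)) 0)\<^sup>2 / 4"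
  shows "\<phi> \<le> w" "w \<le> \<phi> + (\<beta> + 1)\<^sup>2 / 4"
proof -
  have "\<phi> \<le> w \<and> w \<le> \<phi> + (\<beta> + 1)\<^sup>2 / 4"
  proof (cases "r \<le> \<beta> + 1")
    case True
    have "w - \<phi> = r * (2 * (\<beta> + 1) - r) / 4"
      using True by (simp add: w_def \<phi>_def power2_eq_square field_simps)
    moreover have "0 \<le> r * (2 * (\<beta> + 1) - r)" using True assms by (intro mult_nonneg_nonneg) auto
    moreover have "r * (2 * (\<beta> + 1) - r) = (\<beta> + 1)\<^sup>2 - (\<beta> + 1 - r)\<^sup>2"
      by (simp add: power2_eq_square algebra_simps)
    ultimately show ?thesis using zero_le_power2[of "\<beta> + 1 - r"] by linarith
  next
    case False
    have "w = \<phi> + (\<beta> + 1)\<^sup>2 / 4"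
      using False by (simp add: w_def \<phi>_def max_def power2_eq_square field_simps)
    then show ?thesis by simp
  qed
  then show "\<phi> \<le> w" "w \<le> \<phi> + (\<beta> + 1)\<^sup>2 / 4" by auto
qed

section \<open>Change of weight and removal of the regularisation\<close>

lemma entropy_integrand_nonneg:
  assumes "0 < y" "0 < (c::real)"
  shows "0 \<le> y * ln y - y * ln c - y + c"
proof -
  have "ln (c / y) \<le> c / y - 1" using assms by (intro ln_le_minus_one) simp
  then have "y * ln (c / y) \<le> y * (c / y - 1)" using assms by (intro mult_left_mono) auto
  then show ?thesis using assms by (simp add: ln_div algebra_simps)
qed

text \<open>
  The Holley-Stroock argument. The entropy for a weight is the minimum over \<open>c > 0\<close> of the integral
  of the nonnegative function \<open>F ln F - F ln c - F + c\<close>, attained at the mean of \<open>F\<close>. The mean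
  with respect to \<open>q\<close> is a competitor for the weight \<open>p\<close>, and the integral of a nonnegative
  function grows by at most the factor \<open>R\<close> when \<open>q\<close> is replaced by \<open>p\<close>.
\<close>

lemma entropy_comparison:
  fixes F p q :: "'a \<Rightarrow> real"
  assumes F: "\<And>x. 0 < F x"
    and p: "integrable M p" "integrable M (\<lambda>x. F x * p x)" "integrable M (\<lambda>x. F x * ln (F x) * p x)"
    and q: "integrable M q" "integrable M (\<lambda>x. F x * q x)" "integrable M (\<lambda>x. F x * ln (F x) * q x)"
    and pq: "\<And>x. p x \<le> R * q x"
    and pos: "0 < (LINT x|M. p x)" "0 < (LINT x|M. q x)" "0 < (LINT x|M. F x * p x)" "0 < (LINT x|M. F x * q x)"
  shows "(LINT x|M. F x * ln (F x) * p x)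
      - (LINT x|M. F x * p x) * ln ((LINT x|M. F x * p x) / (LINT x|M. p x))
    \<le> R * ((LINT x|M. F x * ln (F x) * q x)
      - (LINT x|M. F x * q x) * ln ((LINT x|M. F x * q x) / (LINT x|M. q x)))"
proof -
  define Zp Zq Ap Aq where "Zp = (LINT x|M. p x)" and "Zq = (LINT x|M. q x)"
    and "Ap = (LINT x|M. F x * p x)" and "Aq = (LINT x|M. F x * q x)"
  note defs = this
  have pos': "0 < Zp" "0 < Zq" "0 < Ap" "0 < Aq" using pos by (auto simp: defs)
  define c where "c = Aq / Zq"
  have c: "0 < c" using pos' by (simp add: c_def)
  define h where "h x = F x * ln (F x) - F x * ln c - F x + c" for x
  have h: "0 \<le> h x" for x unfolding h_def by (rule entropy_integrand_nonneg[OF F c])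
  have expand: "integrable M (\<lambda>x. h x * s x) \<and> (LINT x|M. h x * s x)
      = (LINT x|M. F x * ln (F x) * s x) - (LINT x|M. F x * s x) * ln c - (LINT x|M. F x * s x) + c * (LINT x|M. s x)"
    if s: "integrable M s" "integrable M (\<lambda>x. F x * s x)" "integrable M (\<lambda>x. F x * ln (F x) * s x)" for s
  proof -
    have eq: "(\<lambda>x. h x * s x) = (\<lambda>x. F x * ln (F x) * s x - F x * s x * ln c - F x * s x + c * s x)"
      by (simp add: h_def fun_eq_iff algebra_simps)
    show ?thesis unfolding eq using s by simp
  qed
  have "(LINT x|M. h x * p x) \<le> (LINT x|M. R * (h x * q x))"
  proof (rule integral_mono)
    fix x
    have "h x * p x \<le> h x * (R * q x)" using h pq by (intro mult_left_mono) auto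
    then show "h x * p x \<le> R * (h x * q x)" by (simp add: mult_ac)
  qed (use expand[OF p] expand[OF q] in auto)
  also have "\<dots> = R * (LINT x|M. h x * q x)" by simp
  also have "(LINT x|M. h x * q x) = (LINT x|M. F x * ln (F x) * q x) - Aq * ln (Aq / Zq)"
    using expand[OF q] pos' unfolding defs[symmetric] by (simp add: c_def)
  finally have upper: "(LINT x|M. h x * p x) \<le> R * ((LINT x|M. F x * ln (F x) * q x) - Aq * ln (Aq / Zq))" .
  \<comment> \<open>Optimality of the mean \<open>Ap / Zp\<close> among all constants for the weight \<open>p\<close>\<close>
  have "0 \<le> Zp * (Ap / Zp * ln (Ap / Zp) - Ap / Zp * ln c - Ap / Zp + c)"
    using pos' c by (intro mult_nonneg_nonneg entropy_integrand_nonneg) auto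
  also have "\<dots> = Ap * ln (Ap / Zp) - Ap * ln c - Ap + c * Zp"
    using pos' by (simp add: algebra_simps)
  finally have "(LINT x|M. F x * ln (F x) * p x) - Ap * ln (Ap / Zp) \<le> (LINT x|M. h x * p x)"
    using expand[OF p] unfolding defs[symmetric] by simp
  with upper show ?thesis unfolding defs by linarith
qed

lemma xlnx_tendsto:
  fixes y :: real
  assumes "0 \<le> y"
  shows "(\<lambda>k. (y + 1 / real (Suc k)) * ln (y + 1 / real (Suc k))) \<longlonglongrightarrow> y * ln y"
proof (cases "y = 0")
  case True
  then show ?thesis by simp real_asymp
next
  case False
  with assms have "0 < y" by simp
  have "(\<lambda>k. y + 1 / real (Suc k)) \<longlonglongrightarrow> y + 0"
    by (intro tendsto_intros LIMSEQ_Suc[OF lim_1_over_n])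
  then show ?thesis using \<open>0 < y\<close> by (auto intro!: tendsto_intros)
qed

lemma abs_xlnx_le:
  fixes y :: real
  assumes "0 < y"
  shows "\<bar>y * ln y\<bar> \<le> 1 + y\<^sup>2"
proof -
  have "y * ln y \<le> y * (y - 1)" using assms by (intro mult_left_mono ln_le_minus_one) auto
  moreover have "y * ln y \<ge> y - 1" using entropy_integrand_nonneg[OF assms, of 1] by simp
  moreover have "y * (y - 1) = y\<^sup>2 - y" by (simp add: power2_eq_square algebra_simps)
  ultimately show ?thesis using assms zero_le_power2[of y] by (intro abs_leI) linarith+
qed

lemma weight_eq: "weight \<beta> d x = exp (- ((\<Sum>i<d. (x i)\<^sup>2)\<^sup>2 / 4 - \<beta> * (\<Sum>i<d. (x i)\<^sup>2) / 2))"
proof -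
  have "(L2_set x {..<d}) ^ 4 = ((L2_set x {..<d})\<^sup>2)\<^sup>2" by simp
  moreover have "(L2_set x {..<d})\<^sup>2 = (\<Sum>i<d. (x i)\<^sup>2)"
    by (simp add: L2_set_def sum_nonneg)
  ultimately show ?thesis unfolding weight_def by simp
qed

lemma integral_gibbs:
  assumes "h \<in> borel_measurable (lebesgue_measure d)"
  shows "(LINT x|gibbs \<beta> d. h x)
    = (LINT x|lebesgue_measure d. h x * weight \<beta> d x) / (LINT x|lebesgue_measure d. weight \<beta> d x)"
proof -
  have "0 < (LINT x|lebesgue_measure d. weight \<beta> d x)"
    by (rule integral_pos_lebesgue_measure) (simp_all add: integrable_weight weight_pos)
  then show ?thesis
    unfolding gibbs_def using assms
    by (subst integral_density) (auto simp: less_imp_le[OF weight_pos] mult.commute)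
qed

text \<open>
  Passing from \<open>exp (- W)\<close> to the given weight costs the factor \<open>exp ((\<beta> + 1)\<^sup>2 / 4)\<close> in the
  entropy and nothing in the energy, since \<open>exp (- W)\<close> is the smaller of the two weights.
\<close>

lemma log_sobolev_weight:
  assumes \<beta>: "0 < \<beta>" and \<epsilon>: "0 < \<epsilon>" and f: "f \<in> Cc_infty d"
  defines "F \<equiv> \<lambda>x. (f x)\<^sup>2 + \<epsilon>" and "w \<equiv> weight \<beta> d"
  defines "a \<equiv> LINT x|lebesgue_measure d. F x * w x"
  shows "(LINT x|lebesgue_measure d. F x * ln (F x) * w x) - a * ln (a / (LINT x|lebesgue_measure d. w x))
    \<le> 2 * exp ((\<beta> + 1)\<^sup>2 / 4) * (LINT x|lebesgue_measure d. (\<Sum>i<d. (partial_deriv i f x)\<^sup>2) * w x)"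
proof -
  let ?L = "lebesgue_measure d"
  define W where "W x = 1 / 2 * (\<Sum>i<d. (x i)\<^sup>2) + (max ((\<Sum>i<d. (x i)\<^sup>2) - (\<beta> + 1)) 0)\<^sup>2 / 4" for x :: "nat \<Rightarrow> real"
  have [measurable]: "W \<in> borel_measurable ?L"
    unfolding W_def lebesgue_measure_def by measurable
  have [measurable]: "w \<in> borel_measurable ?L" by (simp add: w_def)
  have sc: "strongly_convex d 1 W"
    unfolding W_def by (rule strongly_convex_radial[OF convex_on_square_positive_part])
      (auto intro!: monoI divide_right_mono power_mono)
  have W_le: "exp (- W x) \<le> w x" and w_le: "w x \<le> exp ((\<beta> + 1)\<^sup>2 / 4) * exp (- W x)" for x
    using quartic_within_bounded_distance_of_convex[OF \<beta>, of "\<Sum>i<d. (x i)\<^sup>2"]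
    unfolding w_def weight_eq W_def exp_add[symmetric] exp_le_cancel_iff
    by (auto simp: sum_nonneg)
  have w_pos: "0 < w x" for x by (simp add: w_def weight_pos)
  have int_w: "integrable ?L w" unfolding w_def by (rule integrable_weight)
  have int_W: "integrable ?L (\<lambda>x. exp (- W x))"
  proof (rule Bochner_Integration.integrable_bound[OF int_w])
    show "AE x in ?L. norm (exp (- W x)) \<le> norm (w x)"
      using W_le w_pos by (intro AE_I2) (simp add: abs_of_pos)
  qed measurable
  obtain M where M: "0 \<le> M" "\<And>x. x \<in> topspace (euclid d) \<Longrightarrow> \<bar>f x\<bar> \<le> M"
    by (rule Cc_infty_uniform_bounds[OF f]) (rule that)
  have [measurable]: "f \<in> borel_measurable ?L" by (rule Cc_infty_measurable[OF f])
  have [measurable]: "F \<in> borel_measurable ?L" unfolding F_def by measurable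
  have F: "0 < F x" for x using \<epsilon> by (auto simp: F_def add_nonneg_pos)
  have F_le: "F x \<le> M\<^sup>2 + \<epsilon>" if "x \<in> space ?L" for x
    using M(2)[of x] that
    by (simp add: space_lebesgue_measure F_def abs_le_square_iff[symmetric] abs_of_nonneg[OF M(1)])
  have int_F: "integrable ?L (\<lambda>x. F x * s x)" if "integrable ?L s" for s
    by (rule integrable_bounded_mult[OF that]) (use F F_le in \<open>auto simp: less_imp_le\<close>)
  have int_FlnF: "integrable ?L (\<lambda>x. F x * ln (F x) * s x)" if "integrable ?L s" for s
  proof (rule integrable_bounded_mult[OF that])
    fix x assume "x \<in> space ?L"
    then have "(F x)\<^sup>2 \<le> (M\<^sup>2 + \<epsilon>)\<^sup>2" using F[of x] F_le by (intro power_mono) (auto simp: less_imp_le)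
    then show "\<bar>F x * ln (F x)\<bar> \<le> 1 + (M\<^sup>2 + \<epsilon>)\<^sup>2" using abs_xlnx_le[OF F[of x]] by linarith
  qed measurable
  have "(LINT x|?L. F x * ln (F x) * w x) - a * ln (a / (LINT x|?L. w x))
    \<le> exp ((\<beta> + 1)\<^sup>2 / 4) * ((LINT x|?L. F x * ln (F x) * exp (- W x))
      - (LINT x|?L. F x * exp (- W x)) * ln ((LINT x|?L. F x * exp (- W x)) / (LINT x|?L. exp (- W x))))"
    unfolding a_def
    by (rule entropy_comparison)
       (use F w_le w_pos in \<open>auto intro!: integral_pos_lebesgue_measure int_F int_FlnF int_w int_W\<close>)
  also have "\<dots> \<le> exp ((\<beta> + 1)\<^sup>2 / 4) * (2 / 1 * (LINT x|?L. (\<Sum>i<d. (partial_deriv i f x)\<^sup>2) * exp (- W x)))"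
    unfolding F_def
    by (intro mult_left_mono log_sobolev_strongly_convex_Cc[OF _ \<epsilon> f sc]) (auto intro: int_W)
  also have "\<dots> \<le> exp ((\<beta> + 1)\<^sup>2 / 4) * (2 / 1 * (LINT x|?L. (\<Sum>i<d. (partial_deriv i f x)\<^sup>2) * w x))"
    by (intro mult_left_mono integral_mono integrable_sum_partial_deriv_square f int_W int_w W_le) (auto intro: sum_nonneg)
  finally show ?thesis by simp
qed

theorem theorem4p6:
  "\<forall>\<beta>::real. 0 < \<beta> \<and> \<beta> < 1 / 2 \<longrightarrow>
     (\<exists>c::real. c > 0 \<and>
        (\<forall>d::nat. d \<ge> 1 \<longrightarrow>
           (\<forall>f\<in>Cc_infty d.
              Ent (gibbs \<beta> d) (\<lambda>x. (f x)\<^sup>2)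
                \<le> c * (LINT x|gibbs \<beta> d. (L2_set (grad d f x) {..<d})\<^sup>2))))"
proof (intro allI impI)
  fix \<beta> :: real assume "0 < \<beta> \<and> \<beta> < 1 / 2"
  then have \<beta>: "0 < \<beta>" by simp
  define c where "c = 2 * exp ((\<beta> + 1)\<^sup>2 / 4)"
  have "Ent (gibbs \<beta> d) (\<lambda>x. (f x)\<^sup>2) \<le> c * (LINT x|gibbs \<beta> d. (L2_set (grad d f x) {..<d})\<^sup>2)"
    if f: "f \<in> Cc_infty d" for d f
  proof -
    let ?L = "lebesgue_measure d" and ?w = "weight \<beta> d"
    define Z where "Z = (LINT x|?L. ?w x)"
    define E where "E = (LINT x|?L. (\<Sum>i<d. (partial_deriv i f x)\<^sup>2) * ?w x)"
    define A where "A = (LINT x|?L. (f x)\<^sup>2 * ?w x)"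
    have Z: "0 < Z"
      unfolding Z_def by (rule integral_pos_lebesgue_measure) (simp_all add: integrable_weight weight_pos)
    have [measurable]: "f \<in> borel_measurable ?L" by (rule Cc_infty_measurable[OF f])
    have [measurable]: "partial_deriv i f \<in> borel_measurable ?L" if "i < d" for i
      by (rule Cc_infty_partial_deriv[OF f that])
    obtain M where M: "0 \<le> M" "\<And>x. x \<in> topspace (euclid d) \<Longrightarrow> \<bar>f x\<bar> \<le> M"
      by (rule Cc_infty_uniform_bounds[OF f]) (rule that)
    have f2_le: "(f x)\<^sup>2 \<le> M\<^sup>2" if "x \<in> space ?L" for x
      using M(2)[of x] that by (simp add: space_lebesgue_measure abs_le_square_iff[symmetric] abs_of_nonneg[OF M(1)])
    have int_f2: "integrable ?L (\<lambda>x. (f x)\<^sup>2 * ?w x)"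
      by (rule integrable_bounded_mult[OF integrable_weight]) (use f2_le in auto)
    have A: "0 \<le> A"
      unfolding A_def by (intro Bochner_Integration.integral_nonneg) (simp add: less_imp_le[OF weight_pos])
    define e where "e k = 1 / real (Suc k)" for k
    have e: "0 < e k" "e k \<le> 1" for k by (auto simp: e_def)
    \<comment> \<open>The bound for \<open>f\<^sup>2 + e k\<close> does not depend on \<open>k\<close> on the right, so \<open>e k \<rightarrow> 0\<close> affects the entropy only.\<close>
    have eq: "(LINT x|?L. ((f x)\<^sup>2 + e k) * ?w x) = A + e k * Z" for k
      using int_f2 integrable_weight[of d \<beta>] by (simp add: A_def Z_def distrib_right)
    have bound: "(LINT x|?L. ((f x)\<^sup>2 + e k) * ln ((f x)\<^sup>2 + e k) * ?w x)
        - Z * ((A / Z + e k) * ln (A / Z + e k)) \<le> c * E" for k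
    proof -
      have "(A + e k * Z) / Z = A / Z + e k" "Z * (A / Z + e k) = A + e k * Z"
        using Z by (auto simp: field_simps)
      then show ?thesis
        using log_sobolev_weight[OF \<beta> e(1) f, of k]
        unfolding eq Z_def[symmetric] E_def[symmetric] c_def[symmetric]
        by (simp add: mult.assoc[symmetric])
    qed
    have "(\<lambda>k. LINT x|?L. ((f x)\<^sup>2 + e k) * ln ((f x)\<^sup>2 + e k) * ?w x)
        \<longlonglongrightarrow> (LINT x|?L. (f x)\<^sup>2 * ln ((f x)\<^sup>2) * ?w x)"
    proof (rule integral_dominated_convergence[where w = "\<lambda>x. (1 + (M\<^sup>2 + 1)\<^sup>2) * ?w x"])
      show "AE x in ?L. (\<lambda>k. ((f x)\<^sup>2 + e k) * ln ((f x)\<^sup>2 + e k) * ?w x) \<longlonglongrightarrow> (f x)\<^sup>2 * ln ((f x)\<^sup>2) * ?w x"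
        unfolding e_def by (intro AE_I2 tendsto_mult xlnx_tendsto tendsto_const) simp
      fix k
      show "AE x in ?L. norm (((f x)\<^sup>2 + e k) * ln ((f x)\<^sup>2 + e k) * ?w x) \<le> (1 + (M\<^sup>2 + 1)\<^sup>2) * ?w x"
      proof (rule AE_I2)
        fix x assume "x \<in> space ?L"
        then have "(f x)\<^sup>2 + e k \<le> M\<^sup>2 + 1" using f2_le e(2)[of k] by (intro add_mono) auto
        then have "((f x)\<^sup>2 + e k)\<^sup>2 \<le> (M\<^sup>2 + 1)\<^sup>2"
          by (rule power_mono) (simp add: less_imp_le[OF e(1)])
        then have "\<bar>((f x)\<^sup>2 + e k) * ln ((f x)\<^sup>2 + e k)\<bar> \<le> 1 + (M\<^sup>2 + 1)\<^sup>2"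
          using abs_xlnx_le[of "(f x)\<^sup>2 + e k"] e(1)[of k] by (smt (verit) zero_le_power2)
        then show "norm (((f x)\<^sup>2 + e k) * ln ((f x)\<^sup>2 + e k) * ?w x) \<le> (1 + (M\<^sup>2 + 1)\<^sup>2) * ?w x"
          by (simp add: abs_mult abs_of_pos[OF weight_pos] mult_right_mono less_imp_le[OF weight_pos])
      qed
    qed (use integrable_weight in simp_all)
    moreover have "(\<lambda>k. (A / Z + e k) * ln (A / Z + e k)) \<longlonglongrightarrow> A / Z * ln (A / Z)"
      unfolding e_def using A Z by (intro xlnx_tendsto) simp
    ultimately have "(\<lambda>k. (LINT x|?L. ((f x)\<^sup>2 + e k) * ln ((f x)\<^sup>2 + e k) * ?w x)
        - Z * ((A / Z + e k) * ln (A / Z + e k)))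
      \<longlonglongrightarrow> (LINT x|?L. (f x)\<^sup>2 * ln ((f x)\<^sup>2) * ?w x) - Z * (A / Z * ln (A / Z))"
      by (intro tendsto_diff tendsto_mult_left)
    then have "(LINT x|?L. (f x)\<^sup>2 * ln ((f x)\<^sup>2) * ?w x) - Z * (A / Z * ln (A / Z)) \<le> c * E"
      by (rule LIMSEQ_le_const2) (use bound in blast)
    then have "((LINT x|?L. (f x)\<^sup>2 * ln ((f x)\<^sup>2) * ?w x) - Z * (A / Z * ln (A / Z))) / Z \<le> c * E / Z"
      using Z by (intro divide_right_mono) auto
    then have "(LINT x|?L. (f x)\<^sup>2 * ln ((f x)\<^sup>2) * ?w x) / Z - A / Z * ln (A / Z) \<le> c * (E / Z)"
      using Z by (simp add: diff_divide_distrib)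
    moreover have "(L2_set (grad d f x) {..<d})\<^sup>2 = (\<Sum>i<d. (partial_deriv i f x)\<^sup>2)" for x
      by (simp add: L2_set_def grad_def sum_nonneg)
    ultimately show ?thesis
      by (simp add: Ent_def integral_gibbs A_def Z_def E_def)
  qed
  then show "\<exists>c::real. c > 0 \<and> (\<forall>d::nat. d \<ge> 1 \<longrightarrow> (\<forall>f\<in>Cc_infty d.
      Ent (gibbs \<beta> d) (\<lambda>x. (f x)\<^sup>2) \<le> c * (LINT x|gibbs \<beta> d. (L2_set (grad d f x) {..<d})\<^sup>2)))"
    by (intro exI[of _ c]) (auto simp: c_def)
qed

end
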